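(* Let $\Lambda$ be a finitely aligned $k$-graph. With the topology on the path space $W$ having as a base the sets $\mathcal Z(\mu\setminus G)$, where $\mu\in\Lambda$ and $G\subset\bigcup_{i=1}^k (s(\mu)\Lambda^{e_i})$ is finite (equivalently, the initial topology induced by $\alpha:W\to\{0,1\}^\Lambda$, $\alpha(w)(y)=1$ if $w\in\mathcal Z(y)$ and $0$ otherwise), $W$ is a locally compact Hausdorff space.
   Context: Conventions: $\mathbb N=\{0,1,2,\dots\}$; $e_1,\dots,e_k$ are the standard generators of $\mathbb N^k$; $(\mathbb N\cup\{\infty\})^k$ is ordered coordinatewise; $\wedge,\vee$ are coordinatewise minimum and maximum. A $k$-graph is a countable category $\Lambda$ with a functor $d:\Lambda\to\mathbb N^k$ (degree) satisfying the factorisation property: whenever $d(\lambda)=m+n$ there are unique $\mu,\nu$ with $\lambda=\mu\nu$, $d(\mu)=m$, $d(\nu)=n$. Morphisms are called paths, $\lambda\in\Lambda$ means $\lambda$ is a morphism, $r,s$ are codomain and domain ($\lambda\mu$ is defined iff $s(\lambda)=r(\mu)$). $\Lambda^n=d^{-1}(n)$, and $\Lambda^0$ is identified with the objects (vertices). $vF=\{\lambda\in F: r(\lambda)=v\}$. A $k$-graph morphism is a degree-preserving functor. For $m\in(\mathbb N\cup\{\infty\})^k$, $\Omega_{k,m}$ is the $k$-graph with objects $p\in\mathbb N^k$, $p\le m$, morphisms $(p,q)$ with $p\le q\le m$, $r(p,q)=p$, $s(p,q)=q$, $d(p,q)=q-p$, $(p,q)(q,t)=(p,t)$. $\Lambda^m$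 also denotes the set of $k$-graph morphisms $x:\Omega_{k,m}\to\Lambda$, and $d(x):=m$; for $m\in\mathbb N^k$ these are identified with the paths $\lambda$ of degree $m$, where $\lambda(p,q)$ is the unique $\lambda''$ with $\lambda=\lambda'\lambda''\lambda'''$, $d(\lambda')=p$, $d(\lambda'')=q-p$. The path space is $W=W_\Lambda=\bigcup_{m\in(\mathbb N\cup\{\infty\})^k}\Lambda^m$. $\mathrm{MCE}(\mu,\nu)$ is the set of $\lambda\in\Lambda$ with $\lambda=\mu\alpha=\nu\beta$ for some $\alpha,\beta\in\Lambda$ and $d(\lambda)=d(\mu)\vee d(\nu)$. $\Lambda$ is finitely aligned if $\mathrm{MCE}(\mu,\nu)$ is finite (possibly empty) for all $\mu,\nu\in\Lambda$. Cylinder sets: $\mathcal Z(\mu)=\{x\in W: d(x)\ge d(\mu),\ x(0,d(\mu))=\mu\}$ for $\mu\in\Lambda$; for finite $G\subset s(\mu)\Lambda$, $\mathcal Z(\mu\setminus G)=\mathcal Z(\mu)\setminus\bigcup_{\nu\in G}\mathcal Z(\mu\nu)$. *)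

theory Defs
  imports "HOL-Analysis.Analysis" "HOL-Library.Extended_Nat" "HOL-Library.Function_Algebras"
    "HOL-Library.Countable_Set"
begin

section \<open>Degrees\<close>

text \<open>
  An element of \<open>\<nat>\<^sup>k\<close> is a function that vanishes outside \<open>{..<k}\<close>. The order, the meet and join
  (\<open>inf\<close>, \<open>sup\<close>), addition and subtraction are then the pointwise operations on functions.
\<close>

definition degrees :: "nat \<Rightarrow> (nat \<Rightarrow> nat) set" where
  "degrees k = {n. \<forall>i\<ge>k. n i = 0}"

definition ext_degrees :: "nat \<Rightarrow> (nat \<Rightarrow> enat) set" where
  "ext_degrees k = {m. \<forall>i\<ge>k. m i = 0}"

definition unit_degree :: "nat \<Rightarrow> nat \<Rightarrow> nat" where
  "unit_degree i = (\<lambda>j. if j = i then 1 else 0)"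

definition to_ext :: "(nat \<Rightarrow> nat) \<Rightarrow> nat \<Rightarrow> enat" where
  "to_ext n = (\<lambda>i. enat (n i))"


section \<open>Categories and \<open>k\<close>-graphs\<close>

text \<open>The composite \<open>cmp \<Lambda> \<kappa> \<mu>\<close> is meaningful only if \<open>src \<Lambda> \<kappa> = rng \<Lambda> \<mu>\<close>.\<close>

record ('o, 'm) category_data =
  Obj :: "'o set"
  Mor :: "'m set"
  rng :: "'m \<Rightarrow> 'o"
  src :: "'m \<Rightarrow> 'o"
  ident :: "'o \<Rightarrow> 'm"
  cmp :: "'m \<Rightarrow> 'm \<Rightarrow> 'm"

record ('o, 'm) kgraph_data = "('o, 'm) category_data" +
  deg :: "'m \<Rightarrow> nat \<Rightarrow> nat"

locale small_category =
  fixes C :: "('o, 'm, 'z) category_data_scheme"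
  assumes rng_Obj: "\<kappa> \<in> Mor C \<Longrightarrow> rng C \<kappa> \<in> Obj C"
    and src_Obj: "\<kappa> \<in> Mor C \<Longrightarrow> src C \<kappa> \<in> Obj C"
    and ident_Mor: "v \<in> Obj C \<Longrightarrow> ident C v \<in> Mor C"
    and rng_ident: "v \<in> Obj C \<Longrightarrow> rng C (ident C v) = v"
    and src_ident: "v \<in> Obj C \<Longrightarrow> src C (ident C v) = v"
    and cmp_Mor: "\<lbrakk>\<kappa> \<in> Mor C; \<mu> \<in> Mor C; src C \<kappa> = rng C \<mu>\<rbrakk> \<Longrightarrow> cmp C \<kappa> \<mu> \<in> Mor C"
    and rng_cmp: "\<lbrakk>\<kappa> \<in> Mor C; \<mu> \<in> Mor C; src C \<kappa> = rng C \<mu>\<rbrakk>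
                   \<Longrightarrow> rng C (cmp C \<kappa> \<mu>) = rng C \<kappa>"
    and src_cmp: "\<lbrakk>\<kappa> \<in> Mor C; \<mu> \<in> Mor C; src C \<kappa> = rng C \<mu>\<rbrakk>
                   \<Longrightarrow> src C (cmp C \<kappa> \<mu>) = src C \<mu>"
    and ident_left: "\<kappa> \<in> Mor C \<Longrightarrow> cmp C (ident C (rng C \<kappa>)) \<kappa> = \<kappa>"
    and ident_right: "\<kappa> \<in> Mor C \<Longrightarrow> cmp C \<kappa> (ident C (src C \<kappa>)) = \<kappa>"
    and cmp_assoc: "\<lbrakk>\<kappa> \<in> Mor C; \<mu> \<in> Mor C; \<nu> \<in> Mor C;
                      src C \<kappa> = rng C \<mu>; src C \<mu> = rng C \<nu>\<rbrakk>
                     \<Longrightarrow> cmp C (cmp C \<kappa> \<mu>) \<nu> = cmp C \<kappa> (cmp C \<mu> \<nu>)"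

locale kgraph = small_category \<Lambda>
  for k :: nat and \<Lambda> :: "('o, 'm, 'z) kgraph_data_scheme" +
  assumes countable_Obj: "countable (Obj \<Lambda>)"
    and countable_Mor: "countable (Mor \<Lambda>)"
    and deg_degrees: "\<kappa> \<in> Mor \<Lambda> \<Longrightarrow> deg \<Lambda> \<kappa> \<in> degrees k"
    and deg_ident: "v \<in> Obj \<Lambda> \<Longrightarrow> deg \<Lambda> (ident \<Lambda> v) = 0"
    and deg_cmp: "\<lbrakk>\<kappa> \<in> Mor \<Lambda>; \<mu> \<in> Mor \<Lambda>; src \<Lambda> \<kappa> = rng \<Lambda> \<mu>\<rbrakk>
                   \<Longrightarrow> deg \<Lambda> (cmp \<Lambda> \<kappa> \<mu>) = deg \<Lambda> \<kappa> + deg \<Lambda> \<mu>"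
    and factorisation: "\<lbrakk>\<kappa> \<in> Mor \<Lambda>; m \<in> degrees k; n \<in> degrees k; deg \<Lambda> \<kappa> = m + n\<rbrakk>
      \<Longrightarrow> \<exists>!p. fst p \<in> Mor \<Lambda> \<and> snd p \<in> Mor \<Lambda> \<and> src \<Lambda> (fst p) = rng \<Lambda> (snd p) \<and>
               \<kappa> = cmp \<Lambda> (fst p) (snd p) \<and> deg \<Lambda> (fst p) = m \<and> deg \<Lambda> (snd p) = n"

text \<open>
  A functor is a pair of an object map and a morphism map. Both maps are extensional, so that two
  functors are equal as soon as they agree on objects and on morphisms.
\<close>

definition kgraph_morphism ::
  "('o, 'm, 'y) kgraph_data_scheme \<Rightarrow> ('p, 'n, 'z) kgraph_data_scheme \<Rightarrow>
   ('o \<Rightarrow> 'p) \<times> ('m \<Rightarrow> 'n) \<Rightarrow> bool" where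
  "kgraph_morphism X Y = (\<lambda>(f, g).
     f \<in> Obj X \<rightarrow>\<^sub>E Obj Y \<and> g \<in> Mor X \<rightarrow>\<^sub>E Mor Y \<and>
     (\<forall>\<kappa>\<in>Mor X. rng Y (g \<kappa>) = f (rng X \<kappa>) \<and> src Y (g \<kappa>) = f (src X \<kappa>)) \<and>
     (\<forall>v\<in>Obj X. g (ident X v) = ident Y (f v)) \<and>
     (\<forall>\<kappa>\<in>Mor X. \<forall>\<mu>\<in>Mor X. src X \<kappa> = rng X \<mu> \<longrightarrow> g (cmp X \<kappa> \<mu>) = cmp Y (g \<kappa>) (g \<mu>)) \<and>
     (\<forall>\<kappa>\<in>Mor X. deg Y (g \<kappa>) = deg X \<kappa>))"


section \<open>The path space\<close>

definition Omega ::
  "nat \<Rightarrow> (nat \<Rightarrow> enat) \<Rightarrow> (nat \<Rightarrow> nat, (nat \<Rightarrow> nat) \<times> (nat \<Rightarrow> nat)) kgraph_data" where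
  "Omega k m = \<lparr>
     Obj = {p \<in> degrees k. to_ext p \<le> m},
     Mor = {(p, q). p \<in> degrees k \<and> q \<in> degrees k \<and> p \<le> q \<and> to_ext q \<le> m},
     rng = fst,
     src = snd,
     ident = (\<lambda>p. (p, p)),
     cmp = (\<lambda>(p, q) (q', t). (p, t)),
     deg = (\<lambda>(p, q). q - p)\<rparr>"

lemma countable_degrees: "countable (degrees k)"
proof -
  have "inj_on (\<lambda>n. map n [0..<k]) (degrees k)"
  proof (rule inj_onI)
    fix x y assume a: "x \<in> degrees k" "y \<in> degrees k" "map x [0..<k] = map y [0..<k]"
    show "x = y"
    proof
      fix i show "x i = y i"
        using a by (cases "i < k") (auto simp: degrees_def)
    qed
  qed
  then show ?thesis by (rule countableI')
qed

lemma kgraph_Omega: "kgraph k (Omega k m)"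
proof unfold_locales
  fix \<kappa> a b
  assume k: "\<kappa> \<in> Mor (Omega k m)" and ab: "a \<in> degrees k" "b \<in> degrees k"
    and d: "deg (Omega k m) \<kappa> = a + b"
  obtain p q where pq: "\<kappa> = (p, q)" "p \<in> degrees k" "q \<in> degrees k" "p \<le> q" "to_ext q \<le> m"
    using k by (auto simp: Omega_def)
  have q: "q i = p i + a i + b i" for i
    using fun_cong[OF d, of i] pq(1,4) le_funD[OF pq(4), of i] by (simp add: Omega_def)
  have m: "enat (q i) \<le> m i" for i
    using pq(5) by (simp add: to_ext_def le_fun_def)
  have m': "enat (p i + a i) \<le> m i" for i
    using m[of i] q[of i] by (metis enat_ord_simps(1) le_add1 order_trans)
  show "\<exists>!x. fst x \<in> Mor (Omega k m) \<and> snd x \<in> Mor (Omega k m) \<and>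
     src (Omega k m) (fst x) = rng (Omega k m) (snd x) \<and>
     \<kappa> = cmp (Omega k m) (fst x) (snd x) \<and> deg (Omega k m) (fst x) = a \<and>
     deg (Omega k m) (snd x) = b"
  proof (rule ex1I[of _ "((p, p + a), (p + a, q))"], goal_cases)
    case 1
    then show ?case using pq ab q m m'
      by (auto simp: Omega_def degrees_def le_fun_def to_ext_def fun_eq_iff)
  next
    case (2 x)
    obtain p' r r' q' where x: "x = ((p', r), (r', q'))" by (metis surj_pair)
    have *: "p' = p" "q' = q" "r = r'" "p' \<le> r" "r - p' = a"
      using 2 by (auto simp: Omega_def x pq(1))
    have "r i = p i + a i" for i
      using le_funD[OF *(4), of i] fun_cong[OF *(5), of i] *(1) by simp
    then have "r = p + a" by (simp add: fun_eq_iff)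
    then show ?case using * x by simp
  qed
next
  show "countable (Obj (Omega k m))"
    by (rule countable_subset[OF _ countable_degrees[of k]]) (auto simp: Omega_def)
next
  show "countable (Mor (Omega k m))"
    by (rule countable_subset[OF _ countable_SIGMA[OF countable_degrees[of k] countable_degrees[of k]]])
      (auto simp: Omega_def)
qed (auto simp: Omega_def degrees_def to_ext_def le_fun_def fun_eq_iff intro: order_trans,
     metis enat_ord_simps(1) order_trans)

text \<open>
  A point of the path space is a degree \<open>m\<close> together with a \<open>k\<close>-graph morphism from \<open>Omega k m\<close>.
  Paths \<open>\<kappa>\<close> of finite degree are represented by the corresponding morphisms
  \<open>(p, q) \<mapsto> \<kappa>(p, q)\<close>, not by \<open>\<kappa>\<close> itself.
\<close>

type_synonym ('o, 'm) gpath =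
  "(nat \<Rightarrow> enat) \<times> ((nat \<Rightarrow> nat) \<Rightarrow> 'o) \<times> ((nat \<Rightarrow> nat) \<times> (nat \<Rightarrow> nat) \<Rightarrow> 'm)"

definition path_space :: "nat \<Rightarrow> ('o, 'm, 'z) kgraph_data_scheme \<Rightarrow> ('o, 'm) gpath set" where
  "path_space k \<Lambda> = {(m, x). m \<in> ext_degrees k \<and> kgraph_morphism (Omega k m) \<Lambda> x}"

definition path_deg :: "('o, 'm) gpath \<Rightarrow> nat \<Rightarrow> enat" where
  "path_deg x = fst x"

definition segment :: "('o, 'm) gpath \<Rightarrow> (nat \<Rightarrow> nat) \<Rightarrow> (nat \<Rightarrow> nat) \<Rightarrow> 'm" where
  "segment x p q = snd (snd x) (p, q)"


section \<open>Finite alignment\<close>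

definition MCE :: "('o, 'm, 'z) kgraph_data_scheme \<Rightarrow> 'm \<Rightarrow> 'm \<Rightarrow> 'm set" where
  "MCE \<Lambda> \<mu> \<nu> = {\<kappa> \<in> Mor \<Lambda>.
     (\<exists>\<alpha>\<in>Mor \<Lambda>. \<exists>\<beta>\<in>Mor \<Lambda>. src \<Lambda> \<mu> = rng \<Lambda> \<alpha> \<and> src \<Lambda> \<nu> = rng \<Lambda> \<beta> \<and>
        \<kappa> = cmp \<Lambda> \<mu> \<alpha> \<and> \<kappa> = cmp \<Lambda> \<nu> \<beta>) \<and>
     deg \<Lambda> \<kappa> = sup (deg \<Lambda> \<mu>) (deg \<Lambda> \<nu>)}"

definition finitely_aligned :: "('o, 'm, 'z) kgraph_data_scheme \<Rightarrow> bool" where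
  "finitely_aligned \<Lambda> \<longleftrightarrow> (\<forall>\<mu>\<in>Mor \<Lambda>. \<forall>\<nu>\<in>Mor \<Lambda>. finite (MCE \<Lambda> \<mu> \<nu>))"


section \<open>The topology of the path space\<close>

definition cylinder :: "nat \<Rightarrow> ('o, 'm, 'z) kgraph_data_scheme \<Rightarrow> 'm \<Rightarrow> ('o, 'm) gpath set" where
  "cylinder k \<Lambda> \<mu> = {x \<in> path_space k \<Lambda>.
     to_ext (deg \<Lambda> \<mu>) \<le> path_deg x \<and> segment x 0 (deg \<Lambda> \<mu>) = \<mu>}"

definition cylinder_diff ::
  "nat \<Rightarrow> ('o, 'm, 'z) kgraph_data_scheme \<Rightarrow> 'm \<Rightarrow> 'm set \<Rightarrow> ('o, 'm) gpath set" where
  "cylinder_diff k \<Lambda> \<mu> G = cylinder k \<Lambda> \<mu> - (\<Union>\<nu>\<in>G. cylinder k \<Lambda> (cmp \<Lambda> \<mu> \<nu>))"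

definition edges_at :: "nat \<Rightarrow> ('o, 'm, 'z) kgraph_data_scheme \<Rightarrow> 'o \<Rightarrow> 'm set" where
  "edges_at k \<Lambda> v = (\<Union>i<k. {\<kappa> \<in> Mor \<Lambda>. rng \<Lambda> \<kappa> = v \<and> deg \<Lambda> \<kappa> = unit_degree i})"

definition path_base :: "nat \<Rightarrow> ('o, 'm, 'z) kgraph_data_scheme \<Rightarrow> ('o, 'm) gpath set set" where
  "path_base k \<Lambda> = {cylinder_diff k \<Lambda> \<mu> G | \<mu> G.
     \<mu> \<in> Mor \<Lambda> \<and> finite G \<and> G \<subseteq> edges_at k \<Lambda> (src \<Lambda> \<mu>)}"

text \<open>
  That the unions of members of \<open>path_base\<close> do form a topology is not automatic; without it,
  \<open>openin (path_topology k \<Lambda>)\<close> need not be the family of these unions.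
\<close>

definition path_topology ::
  "nat \<Rightarrow> ('o, 'm, 'z) kgraph_data_scheme \<Rightarrow> ('o, 'm) gpath topology" where
  "path_topology k \<Lambda> = topology (arbitrary union_of (\<lambda>U. U \<in> path_base k \<Lambda>))"

definition cylinder_indicator ::
  "nat \<Rightarrow> ('o, 'm, 'z) kgraph_data_scheme \<Rightarrow> ('o, 'm) gpath \<Rightarrow> 'm \<Rightarrow> nat" where
  "cylinder_indicator k \<Lambda> w = (\<lambda>y\<in>Mor \<Lambda>. if w \<in> cylinder k \<Lambda> y then 1 else 0)"

definition initial_topology ::
  "nat \<Rightarrow> ('o, 'm, 'z) kgraph_data_scheme \<Rightarrow> ('o, 'm) gpath topology" where
  "initial_topology k \<Lambda> = pullback_topology (path_space k \<Lambda>) (cylinder_indicator k \<Lambda>)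
     (product_topology (\<lambda>_. discrete_topology {0, 1}) (Mor \<Lambda>))"

end

(*
  A path x is determined by the set S of all kappa in Lambda with x in Z(kappa), and the sets S that
  arise are exactly the nonempty, prefix-closed sets that meet MCE(mu, nu) for any two of their
  members mu, nu. Each of these conditions involves, for fixed kappa, mu, nu, only finitely
  many coordinates of the indicator function, the last one because MCE(mu, nu) is finite. So Z(mu) is
  identified with a closed subset of {0,1}^Lambda and is compact and open in the initial topology.

  For the base, let F be a finite set of paths and let x be in W. Put nu = x(0, n), where n is the
  minimum of d(x) and a bound of the degrees of F. If a is in F and x is not in Z(a), then a path y
  in Z(nu) that is in Z(a) lies in Z(kappa) for some kappa in MCE(nu, a) other than nu, hence in
  Z(nu beta) for the first edge beta of kappa after nu; there are finitely many such beta, and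
  Z(nu minus G), with G the set of them, agrees with x on all coordinates in F.
*)

theory Submission
  imports Defs
begin

context kgraph
begin

section \<open>Factorisations and prefixes\<close>

definition prefix :: "'m \<Rightarrow> 'm \<Rightarrow> bool" where
  "prefix a \<kappa> \<longleftrightarrow> a \<in> Mor \<Lambda> \<and> (\<exists>b\<in>Mor \<Lambda>. src \<Lambda> a = rng \<Lambda> b \<and> \<kappa> = cmp \<Lambda> a b)"

lemma prefix_cmp:
  "a \<in> Mor \<Lambda> \<Longrightarrow> b \<in> Mor \<Lambda> \<Longrightarrow> src \<Lambda> a = rng \<Lambda> b \<Longrightarrow> prefix a (cmp \<Lambda> a b)"
  unfolding prefix_def by blast

lemma deg_zero_outside: "\<kappa> \<in> Mor \<Lambda> \<Longrightarrow> i \<ge> k \<Longrightarrow> deg \<Lambda> \<kappa> i = 0"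
  using deg_degrees by (auto simp: degrees_def)

lemma factor_exists:
  assumes "\<kappa> \<in> Mor \<Lambda>" "n \<in> degrees k" "n \<le> deg \<Lambda> \<kappa>"
  obtains a b where "a \<in> Mor \<Lambda>" "b \<in> Mor \<Lambda>" "src \<Lambda> a = rng \<Lambda> b" "\<kappa> = cmp \<Lambda> a b"
    "deg \<Lambda> a = n" "deg \<Lambda> b = deg \<Lambda> \<kappa> - n"
proof -
  have d: "deg \<Lambda> \<kappa> - n \<in> degrees k"
    using assms(1) by (auto simp: degrees_def deg_zero_outside)
  have "deg \<Lambda> \<kappa> = n + (deg \<Lambda> \<kappa> - n)"
    using assms(3) by (auto simp: fun_eq_iff le_fun_def)
  from ex1_implies_ex[OF factorisation[OF assms(1,2) d this]] show thesis
    using that by blast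
qed

text \<open>Comparing the first degrees is enough: the degree of the common composite then fixes the
  degrees of the second factors by cancellation in N^k, and the factorisation property applies. Used
  with the same first factor on both sides, part (2) is left cancellation.\<close>

lemma factor_unique:
  assumes "a \<in> Mor \<Lambda>" "b \<in> Mor \<Lambda>" "src \<Lambda> a = rng \<Lambda> b"
    and "a' \<in> Mor \<Lambda>" "b' \<in> Mor \<Lambda>" "src \<Lambda> a' = rng \<Lambda> b'"
    and eq: "cmp \<Lambda> a b = cmp \<Lambda> a' b'" and deg: "deg \<Lambda> a = deg \<Lambda> a'"
  shows "a = a'" "b = b'"
proof -
  have ab: "deg \<Lambda> (cmp \<Lambda> a b) = deg \<Lambda> a + deg \<Lambda> b"
    using assms(1-3) by (rule deg_cmp)
  moreover have "deg \<Lambda> (cmp \<Lambda> a b) = deg \<Lambda> a + deg \<Lambda> b'"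
    using deg_cmp[OF assms(4-6)] eq deg by simp
  ultimately have b: "deg \<Lambda> b' = deg \<Lambda> b" by simp
  note uniq = the1_equality[OF factorisation[OF cmp_Mor[OF assms(1-3)] deg_degrees[OF assms(1)]
    deg_degrees[OF assms(2)] ab]]
  have "(a, b) = (a', b')"
    by (rule trans[OF sym[OF uniq] uniq]) (use assms b in simp_all)
  then show "a = a'" "b = b'" by auto
qed

text \<open>Composing \<kappa> with the identity at its range, or with the identity at its source,
  gives two factorisations of \<kappa> whose first factors both have degree 0. By uniqueness these
  first factors coincide.\<close>

lemma deg_zero_ident:
  assumes "\<kappa> \<in> Mor \<Lambda>" "deg \<Lambda> \<kappa> = 0"
  shows "\<kappa> = ident \<Lambda> (rng \<Lambda> \<kappa>)" "src \<Lambda> \<kappa> = rng \<Lambda> \<kappa>"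
proof -
  show "\<kappa> = ident \<Lambda> (rng \<Lambda> \<kappa>)"
    by (rule factor_unique(1)[of _ "ident \<Lambda> (src \<Lambda> \<kappa>)" _ \<kappa>])
      (use assms in \<open>auto simp: ident_Mor rng_Obj src_Obj rng_ident src_ident ident_left ident_right
        deg_ident\<close>)
  then show "src \<Lambda> \<kappa> = rng \<Lambda> \<kappa>"
    using src_ident[of "rng \<Lambda> \<kappa>"] rng_Obj[of \<kappa>] assms(1) by metis
qed

lemma prefix_same_deg:
  assumes "prefix a \<kappa>" "prefix a' \<kappa>" "deg \<Lambda> a = deg \<Lambda> a'"
  shows "a = a'"
  using assms factor_unique(1) unfolding prefix_def by metis

lemma prefix_full_deg:
  assumes "prefix a \<kappa>" "deg \<Lambda> a = deg \<Lambda> \<kappa>"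
  shows "a = \<kappa>"
proof -
  obtain b where b: "a \<in> Mor \<Lambda>" "b \<in> Mor \<Lambda>" "src \<Lambda> a = rng \<Lambda> b" "\<kappa> = cmp \<Lambda> a b"
    using assms(1) unfolding prefix_def by blast
  then have "deg \<Lambda> b = 0" using deg_cmp[of a b] assms(2) by simp
  then show ?thesis using b deg_zero_ident(1)[of b] ident_right[of a] by metis
qed

lemma prefix_exists:
  assumes "\<kappa> \<in> Mor \<Lambda>" "n \<in> degrees k" "n \<le> deg \<Lambda> \<kappa>"
  obtains a where "prefix a \<kappa>" "deg \<Lambda> a = n"
  using factor_exists[OF assms] unfolding prefix_def by metis

lemma prefix_Mor: "prefix a \<kappa> \<Longrightarrow> a \<in> Mor \<Lambda> \<and> \<kappa> \<in> Mor \<Lambda>"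
  unfolding prefix_def using cmp_Mor by blast

lemma MCE_iff:
  assumes "\<mu> \<in> Mor \<Lambda>" "\<nu> \<in> Mor \<Lambda>"
  shows "\<kappa> \<in> MCE \<Lambda> \<mu> \<nu> \<longleftrightarrow>
    prefix \<mu> \<kappa> \<and> prefix \<nu> \<kappa> \<and> deg \<Lambda> \<kappa> = sup (deg \<Lambda> \<mu>) (deg \<Lambda> \<nu>)"
proof
  assume "\<kappa> \<in> MCE \<Lambda> \<mu> \<nu>"
  then show "prefix \<mu> \<kappa> \<and> prefix \<nu> \<kappa> \<and> deg \<Lambda> \<kappa> = sup (deg \<Lambda> \<mu>) (deg \<Lambda> \<nu>)"
    using assms unfolding MCE_def prefix_def by auto
next
  assume *: "prefix \<mu> \<kappa> \<and> prefix \<nu> \<kappa> \<and> deg \<Lambda> \<kappa> = sup (deg \<Lambda> \<mu>) (deg \<Lambda> \<nu>)"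
  then have "\<kappa> \<in> Mor \<Lambda>" using prefix_Mor by blast
  moreover obtain \<alpha> where "\<alpha> \<in> Mor \<Lambda>" "src \<Lambda> \<mu> = rng \<Lambda> \<alpha>" "\<kappa> = cmp \<Lambda> \<mu> \<alpha>"
    using * unfolding prefix_def by meson
  moreover obtain \<beta> where "\<beta> \<in> Mor \<Lambda>" "src \<Lambda> \<nu> = rng \<Lambda> \<beta>" "\<kappa> = cmp \<Lambda> \<nu> \<beta>"
    using * unfolding prefix_def by meson
  ultimately show "\<kappa> \<in> MCE \<Lambda> \<mu> \<nu>"
    using * unfolding MCE_def mem_Collect_eq
    by (elim conjE, intro conjI bexI[of _ \<alpha>] bexI[of _ \<beta>])
qed

section \<open>Segments of a path\<close>

lemma path_space_morphism:
  assumes "(m, f, g) \<in> path_space k \<Lambda>"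
  shows "f \<in> Obj (Omega k m) \<rightarrow>\<^sub>E Obj \<Lambda>" "g \<in> Mor (Omega k m) \<rightarrow>\<^sub>E Mor \<Lambda>"
    "\<forall>\<kappa>\<in>Mor (Omega k m). rng \<Lambda> (g \<kappa>) = f (rng (Omega k m) \<kappa>) \<and>
      src \<Lambda> (g \<kappa>) = f (src (Omega k m) \<kappa>)"
    "\<forall>\<kappa>\<in>Mor (Omega k m). \<forall>\<mu>\<in>Mor (Omega k m). src (Omega k m) \<kappa> = rng (Omega k m) \<mu> \<longrightarrow>
      g (cmp (Omega k m) \<kappa> \<mu>) = cmp \<Lambda> (g \<kappa>) (g \<mu>)"
    "\<forall>\<kappa>\<in>Mor (Omega k m). deg \<Lambda> (g \<kappa>) = deg (Omega k m) \<kappa>"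
  using assms unfolding path_space_def kgraph_morphism_def mem_Collect_eq prod.case
  by - (elim conjE, assumption)+

lemma path_space_D:
  assumes "x \<in> path_space k \<Lambda>" "p \<in> degrees k" "q \<in> degrees k" "p \<le> q" "to_ext q \<le> path_deg x"
  shows "segment x p q \<in> Mor \<Lambda>" "deg \<Lambda> (segment x p q) = q - p"
    "rng \<Lambda> (segment x p q) = fst (snd x) p" "src \<Lambda> (segment x p q) = fst (snd x) q"
proof -
  obtain m f g where x: "x = (m, f, g)" by (metis surj_pair)
  note D = path_space_morphism[OF assms(1)[unfolded x]]
  have pq: "(p, q) \<in> Mor (Omega k m)"
    using assms by (simp add: x Omega_def path_deg_def)
  then show "segment x p q \<in> Mor \<Lambda>" "deg \<Lambda> (segment x p q) = q - p"
    "rng \<Lambda> (segment x p q) = fst (snd x) p" "src \<Lambda> (segment x p q) = fst (snd x) q"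
    using PiE_mem[OF D(2) pq] bspec[OF D(3) pq] bspec[OF D(5) pq]
    by (simp_all only: x segment_def fst_conv snd_conv) (simp_all add: Omega_def)
qed

lemma to_ext_mono: "p \<le> q \<Longrightarrow> to_ext q \<le> m \<Longrightarrow> to_ext p \<le> m"
  unfolding to_ext_def le_fun_def by (meson enat_ord_simps(1) order_trans)

lemma segment_cmp:
  assumes "x \<in> path_space k \<Lambda>" "p \<in> degrees k" "q \<in> degrees k" "t \<in> degrees k" "p \<le> q" "q \<le> t"
    "to_ext t \<le> path_deg x"
  shows "segment x p t = cmp \<Lambda> (segment x p q) (segment x q t)"
proof -
  obtain m f g where x: "x = (m, f, g)" by (metis surj_pair)
  show ?thesis
    using bspec[OF bspec[OF path_space_morphism(4)[OF assms(1)[unfolded x]], of "(p, q)"],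
        of "(q, t)"] assms(2-) to_ext_mono[OF assms(6,7)]
    by (simp add: x Omega_def segment_def path_deg_def)
qed

lemma zero_degrees: "0 \<in> degrees k"
  by (simp add: degrees_def)

lemma zero_le_degree: "(0 :: nat \<Rightarrow> nat) \<le> n"
  by (simp add: le_fun_def)

lemma segment_prefix:
  assumes "x \<in> path_space k \<Lambda>" "p \<in> degrees k" "q \<in> degrees k" "p \<le> q" "to_ext q \<le> path_deg x"
  shows "prefix (segment x 0 p) (segment x 0 q)"
proof -
  note p = to_ext_mono[OF assms(4,5)]
  note D = path_space_D[OF assms(1)]
  show ?thesis
    unfolding segment_cmp[OF assms(1) zero_degrees assms(2,3) zero_le_degree assms(4,5)]
    by (rule prefix_cmp)
      (simp_all add: D[OF zero_degrees assms(2) zero_le_degree p] D[OF assms(2-5)])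
qed

text \<open>Since \<open>x(0, q) = x(0, p) x(p, q)\<close>, unique factorisation recovers every
  segment from the initial ones. The object map is read off from the ranges of the segments
  \<open>x(p, p)\<close>.\<close>

lemma path_eqI:
  assumes x: "x \<in> path_space k \<Lambda>" and y: "y \<in> path_space k \<Lambda>" and deg: "path_deg x = path_deg y"
    and seg: "\<And>q. q \<in> degrees k \<Longrightarrow> to_ext q \<le> path_deg x \<Longrightarrow> segment x 0 q = segment y 0 q"
  shows "x = y"
proof -
  obtain m f g f' g' where xy: "x = (m, f, g)" "y = (m, f', g')"
    using deg by (cases x; cases y) (auto simp: path_deg_def)
  have ext: "g \<in> extensional (Mor (Omega k m))" "g' \<in> extensional (Mor (Omega k m))"
     "f \<in> extensional (Obj (Omega k m))" "f' \<in> extensional (Obj (Omega k m))"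
    using path_space_morphism(1,2)[OF x[unfolded xy]] path_space_morphism(1,2)[OF y[unfolded xy]]
    unfolding PiE_iff by blast+
  have pq: "g (p, q) = g' (p, q)"
    if "p \<in> degrees k" "q \<in> degrees k" "p \<le> q" "to_ext q \<le> m" for p q
  proof -
    have mx: "path_deg x = m" "path_deg y = m" by (auto simp: xy path_deg_def)
    have p: "to_ext p \<le> m" using to_ext_mono that by blast
    note Dx = path_space_D[OF x, unfolded mx] and Dy = path_space_D[OF y, unfolded mx]
    have "segment x p q = segment y p q"
    proof (rule factor_unique(2)[of "segment x 0 p" _ "segment y 0 p"])
      show "cmp \<Lambda> (segment x 0 p) (segment x p q) = cmp \<Lambda> (segment y 0 p) (segment y p q)"
        using segment_cmp[OF x zero_degrees that(1,2) zero_le_degree that(3)]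
          segment_cmp[OF y zero_degrees that(1,2) zero_le_degree that(3)] that seg[of q]
        by (simp add: mx)
    qed (use that p Dx Dy zero_degrees zero_le_degree in \<open>simp_all\<close>)
    then show ?thesis by (simp add: xy segment_def)
  qed
  have g: "g = g'"
    by (rule extensionalityI[OF ext(1,2)]) (use pq in \<open>auto simp: Omega_def\<close>)
  have "f = f'"
  proof (rule extensionalityI[OF ext(3,4)])
    fix p assume "p \<in> Obj (Omega k m)"
    then have p: "p \<in> degrees k" "to_ext p \<le> m" by (auto simp: Omega_def)
    then show "f p = f' p"
      using path_space_D(3)[OF x p(1) p(1)] path_space_D(3)[OF y p(1) p(1)]
      by (simp add: xy path_deg_def segment_def g)
  qed
  with g show ?thesis by (simp add: xy)
qed

section \<open>Cylinder sets and common extensions\<close>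

lemma segment_in_cylinder:
  assumes "x \<in> path_space k \<Lambda>" "q \<in> degrees k" "to_ext q \<le> path_deg x"
  shows "x \<in> cylinder k \<Lambda> (segment x 0 q)"
  using assms path_space_D(2)[OF assms(1) zero_degrees assms(2) zero_le_degree assms(3)]
  by (simp add: cylinder_def)

lemma cylinder_segment_prefix:
  assumes "x \<in> cylinder k \<Lambda> a" "a \<in> Mor \<Lambda>" "q \<in> degrees k" "to_ext q \<le> path_deg x" "deg \<Lambda> a \<le> q"
  shows "prefix a (segment x 0 q)"
  using assms segment_prefix[of x "deg \<Lambda> a" q] deg_degrees by (auto simp: cylinder_def)

text \<open>Both \<open>a\<close> and \<open>x(0, d(a))\<close> are prefixes of \<kappa>, and they
  have the same degree, so they are equal.\<close>

lemma cylinder_prefix: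
  assumes "x \<in> cylinder k \<Lambda> \<kappa>" "prefix a \<kappa>"
  shows "x \<in> cylinder k \<Lambda> a"
proof -
  have x: "x \<in> path_space k \<Lambda>" "to_ext (deg \<Lambda> \<kappa>) \<le> path_deg x" "segment x 0 (deg \<Lambda> \<kappa>) = \<kappa>"
    using assms(1) by (auto simp: cylinder_def)
  obtain b where b: "a \<in> Mor \<Lambda>" "b \<in> Mor \<Lambda>" "src \<Lambda> a = rng \<Lambda> b" "\<kappa> = cmp \<Lambda> a b"
    using assms(2) unfolding prefix_def by blast
  then have le: "deg \<Lambda> a \<le> deg \<Lambda> \<kappa>" by (simp add: deg_cmp le_fun_def)
  have deg: "deg \<Lambda> a \<in> degrees k" "deg \<Lambda> \<kappa> \<in> degrees k"
    using deg_degrees prefix_Mor assms(2) by auto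
  have le': "to_ext (deg \<Lambda> a) \<le> path_deg x" using to_ext_mono le x(2) by blast
  have "prefix (segment x 0 (deg \<Lambda> a)) \<kappa>"
    using segment_prefix[OF x(1) deg le x(2)] x(3) by simp
  moreover have "deg \<Lambda> (segment x 0 (deg \<Lambda> a)) = deg \<Lambda> a"
    using path_space_D(2)[OF x(1) zero_degrees deg(1) zero_le_degree le'] by simp
  ultimately have "segment x 0 (deg \<Lambda> a) = a"
    using prefix_same_deg assms(2) by blast
  then show ?thesis using x(1) le' by (simp add: cylinder_def)
qed

text \<open>The witness is the segment of \<open>x\<close> from 0 to the join of the two degrees;
  the join lies below \<open>d(x)\<close> because both degrees do.\<close>

lemma cylinder_MCE:
  assumes "x \<in> cylinder k \<Lambda> \<mu>" "x \<in> cylinder k \<Lambda> \<nu>" "\<mu> \<in> Mor \<Lambda>" "\<nu> \<in> Mor \<Lambda>"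
  obtains \<kappa> where "\<kappa> \<in> MCE \<Lambda> \<mu> \<nu>" "x \<in> cylinder k \<Lambda> \<kappa>"
proof -
  let ?n = "sup (deg \<Lambda> \<mu>) (deg \<Lambda> \<nu>)"
  have n: "?n \<in> degrees k" using assms by (auto simp: degrees_def deg_zero_outside)
  have x: "x \<in> path_space k \<Lambda>" using assms(1) by (simp add: cylinder_def)
  have le: "to_ext ?n \<le> path_deg x"
    using assms(1,2) by (auto simp: cylinder_def to_ext_def le_fun_def sup_max max_def)
  show thesis
  proof
    show "segment x 0 ?n \<in> MCE \<Lambda> \<mu> \<nu>"
      using assms n le cylinder_segment_prefix path_space_D(2)[OF x zero_degrees n zero_le_degree le]
      by (auto simp: MCE_iff)
  qed (rule segment_in_cylinder[OF x n le])
qed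

section \<open>Paths as filters of morphisms\<close>

text \<open>Directedness asks for a member of \<open>MCE\<close> rather than for an arbitrary common
  extension: under finite alignment this is a finite disjunction, hence a closed condition on
  indicator functions.\<close>

definition path_filter :: "'m set \<Rightarrow> bool" where
  "path_filter S \<longleftrightarrow> S \<noteq> {} \<and> S \<subseteq> Mor \<Lambda> \<and> (\<forall>\<kappa>\<in>S. \<forall>a. prefix a \<kappa> \<longrightarrow> a \<in> S) \<and>
     (\<forall>\<mu>\<in>S. \<forall>\<nu>\<in>S. \<exists>\<kappa>\<in>MCE \<Lambda> \<mu> \<nu>. \<kappa> \<in> S)"

text \<open>A supremum may be infinite and not attained, but each \<open>q i\<close> is finite, so
  some member of \<open>S\<close> reaches it in coordinate \<open>i\<close>. Directedness combines
  the coordinates, and prefix closure cuts the resulting member down to degree exactly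
  \<open>q\<close>.\<close>

lemma path_filter_attains:
  assumes S: "path_filter S" and q: "q \<in> degrees k"
    and le: "\<And>i. enat (q i) \<le> (SUP \<kappa>\<in>S. enat (deg \<Lambda> \<kappa> i))"
  obtains \<kappa> where "\<kappa> \<in> S" "deg \<Lambda> \<kappa> = q"
proof -
  have ne: "S \<noteq> {}" and Mor: "S \<subseteq> Mor \<Lambda>"
    and pre: "\<And>\<kappa> a. \<kappa> \<in> S \<Longrightarrow> prefix a \<kappa> \<Longrightarrow> a \<in> S"
    and dir: "\<And>\<mu> \<nu>. \<mu> \<in> S \<Longrightarrow> \<nu> \<in> S \<Longrightarrow> \<exists>\<kappa>\<in>MCE \<Lambda> \<mu> \<nu>. \<kappa> \<in> S"
    using S unfolding path_filter_def by blast+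
  have one: "\<exists>\<kappa>\<in>S. q i \<le> deg \<Lambda> \<kappa> i" for i
  proof (cases "q i")
    case 0
    then show ?thesis using ne by auto
  next
    case (Suc j)
    \<comment> \<open>The predecessor \<open>j\<close> of \<open>q i\<close> is strictly below the
      supremum, so some member of \<open>S\<close> has a degree exceeding it.\<close>
    then have "enat j < (SUP \<kappa>\<in>S. enat (deg \<Lambda> \<kappa> i))"
      using le[of i] by (metis enat_ord_simps(2) lessI order_less_le_trans)
    then show ?thesis using Suc by (auto simp: less_SUP_iff Suc_le_eq)
  qed
  \<comment> \<open>The degree of an element of \<open>MCE\<close> is a join, so adding one more
    coordinate keeps the bounds already reached. Taking \<open>j = k\<close> suffices because
    \<open>q\<close> vanishes from \<open>k\<close> on.\<close>
  have "\<exists>\<kappa>\<in>S. \<forall>i<j. q i \<le> deg \<Lambda> \<kappa> i" for j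
  proof (induction j)
    case 0
    then show ?case using ne by auto
  next
    case (Suc j)
    then obtain \<mu> \<nu> where "\<mu> \<in> S" "\<forall>i<j. q i \<le> deg \<Lambda> \<mu> i" "\<nu> \<in> S" "q j \<le> deg \<Lambda> \<nu> j"
      using one by blast
    moreover from this obtain \<kappa> where "\<kappa> \<in> S" "\<kappa> \<in> MCE \<Lambda> \<mu> \<nu>" using dir by blast
    ultimately show ?case
      by (intro bexI[of _ \<kappa>]) (auto simp: MCE_def less_Suc_eq intro: le_supI1 le_supI2)
  qed
  then obtain \<kappa> where \<kappa>: "\<kappa> \<in> S" "\<forall>i<k. q i \<le> deg \<Lambda> \<kappa> i" by blast
  have "q \<le> deg \<Lambda> \<kappa>"
  proof (rule le_funI)
    fix i show "q i \<le> deg \<Lambda> \<kappa> i"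
      using \<kappa>(2) q by (cases "i < k") (auto simp: degrees_def)
  qed
  then obtain a where "prefix a \<kappa>" "deg \<Lambda> a = q"
    using prefix_exists q \<kappa>(1) Mor by blast
  then show thesis using that pre \<kappa>(1) by blast
qed

lemma path_filter_unique:
  assumes "path_filter S" "\<mu> \<in> S" "\<nu> \<in> S" "deg \<Lambda> \<mu> = deg \<Lambda> \<nu>"
  shows "\<mu> = \<nu>"
proof -
  have "\<mu> \<in> Mor \<Lambda>" "\<nu> \<in> Mor \<Lambda>" using assms unfolding path_filter_def by auto
  moreover obtain \<kappa> where "\<kappa> \<in> MCE \<Lambda> \<mu> \<nu>"
    using assms unfolding path_filter_def by blast
  ultimately have "prefix \<mu> \<kappa>" "prefix \<nu> \<kappa>" by (auto simp: MCE_iff)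
  then show ?thesis using prefix_same_deg assms(4) by blast
qed

text \<open>\<open>S\<close> has exactly one member of each finite degree below the supremum of its
  degrees. These members become the initial segments of the path, and the remainder of one after
  another gives the other segments.\<close>

lemma path_of_filter:
  assumes S: "path_filter S"
  obtains x where "x \<in> path_space k \<Lambda>" "\<And>a. a \<in> Mor \<Lambda> \<Longrightarrow> x \<in> cylinder k \<Lambda> a \<longleftrightarrow> a \<in> S"
proof -
  have Mor: "\<And>\<kappa>. \<kappa> \<in> S \<Longrightarrow> \<kappa> \<in> Mor \<Lambda>"
    and pre: "\<And>\<kappa> a. \<kappa> \<in> S \<Longrightarrow> prefix a \<kappa> \<Longrightarrow> a \<in> S"
    using S unfolding path_filter_def by blast+
  \<comment> \<open>The supremum is taken in \<open>enat\<close>, so a coordinate in which the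
    degrees are unbounded becomes an infinite coordinate of the path.\<close>
  define m where "m = (\<lambda>i. SUP \<kappa>\<in>S. enat (deg \<Lambda> \<kappa> i))"
  have m_ext: "m \<in> ext_degrees k"
  proof -
    have "S \<noteq> {}" using S by (simp add: path_filter_def)
    then show ?thesis using Mor by (auto simp: ext_degrees_def m_def deg_zero_outside
          zero_enat_def[symmetric] cong: SUP_cong_simp)
  qed
  have le_m: "to_ext (deg \<Lambda> \<kappa>) \<le> m" if "\<kappa> \<in> S" for \<kappa>
    using that by (auto simp: to_ext_def le_fun_def m_def intro: SUP_upper)
  define P where "P q = (THE \<kappa>. \<kappa> \<in> S \<and> deg \<Lambda> \<kappa> = q)" for q
  have P_eq: "P (deg \<Lambda> \<kappa>) = \<kappa>" if "\<kappa> \<in> S" for \<kappa>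
    unfolding P_def using that path_filter_unique[OF S] by (intro the_equality) auto
  have P: "P q \<in> S" "deg \<Lambda> (P q) = q" if q: "q \<in> degrees k" "to_ext q \<le> m" for q
  proof -
    obtain \<kappa> where "\<kappa> \<in> S" "deg \<Lambda> \<kappa> = q"
      using path_filter_attains[OF S q(1)] q(2) by (auto simp: to_ext_def le_fun_def m_def)
    then show "P q \<in> S" "deg \<Lambda> (P q) = q" using P_eq by auto
  qed
  note PM = Mor[OF P(1)]
  define G where "G p q = (THE b. b \<in> Mor \<Lambda> \<and> src \<Lambda> (P p) = rng \<Lambda> b \<and> P q = cmp \<Lambda> (P p) b)" for p q
  have G_eq: "G p q = b" if "p \<in> degrees k" "to_ext p \<le> m"
    "b \<in> Mor \<Lambda>" "src \<Lambda> (P p) = rng \<Lambda> b" "P q = cmp \<Lambda> (P p) b" for p q b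
    unfolding G_def using that PM[of p] factor_unique(2)[of "P p" _ "P p"]
    by (intro the_equality) auto
  have G: "G p q \<in> Mor \<Lambda>" "src \<Lambda> (P p) = rng \<Lambda> (G p q)" "P q = cmp \<Lambda> (P p) (G p q)"
    "deg \<Lambda> (G p q) = q - p" "src \<Lambda> (G p q) = src \<Lambda> (P q)"
    if pq: "p \<in> degrees k" "q \<in> degrees k" "p \<le> q" "to_ext q \<le> m" for p q
  proof -
    have p: "to_ext p \<le> m" using to_ext_mono pq by blast
    obtain a b where ab: "a \<in> Mor \<Lambda>" "b \<in> Mor \<Lambda>" "src \<Lambda> a = rng \<Lambda> b" "P q = cmp \<Lambda> a b"
      "deg \<Lambda> a = p" "deg \<Lambda> b = q - p"
      using factor_exists[OF PM[OF pq(2,4)] pq(1)] P(2)[OF pq(2,4)] pq(3) by metis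
    \<comment> \<open>Prefix closure puts the factor of degree \<open>p\<close> into
      \<open>S\<close>, so it must be \<open>P p\<close>; the other factor is then the remainder
      \<open>G p q\<close>.\<close>
    then have "a \<in> S" using pre[OF P(1)[OF pq(2,4)]] unfolding prefix_def by blast
    then have a: "P p = a" using P_eq[of a] ab(5) by simp
    have b: "G p q = b" by (rule G_eq[OF pq(1) p]) (simp_all only: a ab(1-4))
    show "G p q \<in> Mor \<Lambda>" "src \<Lambda> (P p) = rng \<Lambda> (G p q)" "P q = cmp \<Lambda> (P p) (G p q)"
      "deg \<Lambda> (G p q) = q - p"
      unfolding a b by (fact ab)+
    show "src \<Lambda> (G p q) = src \<Lambda> (P q)"
      unfolding b ab(4) using src_cmp[OF ab(1-3)] by simp
  qed
  \<comment> \<open>The restrictions make both maps extensional, as \<open>kgraph_morphism\<close>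
    demands.\<close>
  define x where "x = (m, restrict (\<lambda>p. src \<Lambda> (P p)) (Obj (Omega k m)),
    restrict (\<lambda>(p, q). G p q) (Mor (Omega k m)))"
  \<comment> \<open>The identity law and the composition law both follow from uniqueness of
    remainders, \<open>G_eq\<close>: it is enough that the proposed morphism completes
    \<open>P p\<close> to the longer member.\<close>
  have G_id: "G p p = ident \<Lambda> (src \<Lambda> (P p))" if "p \<in> degrees k" "to_ext p \<le> m" for p
    using that PM[OF that] by (intro G_eq) (auto simp: ident_Mor rng_ident src_Obj ident_right)
  have G_cmp: "G p t = cmp \<Lambda> (G p q) (G q t)"
    if "p \<in> degrees k" "q \<in> degrees k" "t \<in> degrees k" "p \<le> q" "q \<le> t" "to_ext t \<le> m" for p q t
  proof -
    have q: "to_ext q \<le> m" using to_ext_mono that by blast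
    have p: "to_ext p \<le> m" using to_ext_mono that q by blast
    note Gpq = G[OF that(1,2,4) q] and Gqt = G[OF that(2,3,5,6)]
    show ?thesis
    proof (rule G_eq[OF that(1) p])
      show "P t = cmp \<Lambda> (P p) (cmp \<Lambda> (G p q) (G q t))"
        using Gpq Gqt cmp_assoc[of "P p" "G p q" "G q t"] PM[OF that(1) p] by simp
    qed (use Gpq Gqt in \<open>auto simp: cmp_Mor rng_cmp\<close>)
  qed
  let ?f = "restrict (\<lambda>p. src \<Lambda> (P p)) (Obj (Omega k m))"
  let ?g = "restrict (\<lambda>(p, q). G p q) (Mor (Omega k m))"
  have Omega_Mor: "(p, q) \<in> Mor (Omega k m) \<longleftrightarrow>
      p \<in> degrees k \<and> q \<in> degrees k \<and> p \<le> q \<and> to_ext q \<le> m" for p q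
    by (simp add: Omega_def)
  have Omega_Obj: "p \<in> Obj (Omega k m) \<longleftrightarrow> p \<in> degrees k \<and> to_ext p \<le> m" for p
    by (simp add: Omega_def)
  have "kgraph_morphism (Omega k m) \<Lambda> (?f, ?g)"
    unfolding kgraph_morphism_def prod.case
  proof (intro conjI ballI impI)
    show "?f \<in> Obj (Omega k m) \<rightarrow>\<^sub>E Obj \<Lambda>"
      using PM src_Obj by (simp add: Omega_Obj PiE_iff)
    show "?g \<in> Mor (Omega k m) \<rightarrow>\<^sub>E Mor \<Lambda>"
      using G(1) by (auto simp: Omega_Mor PiE_iff)
  next
    fix v assume "v \<in> Obj (Omega k m)"
    then show "?g (ident (Omega k m) v) = ident \<Lambda> (?f v)"
      using G_id by (simp add: Omega_def)
  next
    fix \<kappa> assume \<kappa>: "\<kappa> \<in> Mor (Omega k m)"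
    obtain p q where pq: "\<kappa> = (p, q)" by (metis surj_pair)
    note * = \<kappa>[unfolded pq Omega_Mor]
    have p: "p \<in> Obj (Omega k m)" "q \<in> Obj (Omega k m)"
      using * to_ext_mono unfolding Omega_Obj by blast+
    have **: "?g \<kappa> = G p q" "rng (Omega k m) \<kappa> = p" "src (Omega k m) \<kappa> = q"
        "deg (Omega k m) \<kappa> = q - p"
      using \<kappa> by (simp_all add: pq) (simp_all add: Omega_def)
    show "rng \<Lambda> (?g \<kappa>) = ?f (rng (Omega k m) \<kappa>)" "src \<Lambda> (?g \<kappa>) = ?f (src (Omega k m) \<kappa>)"
      "deg \<Lambda> (?g \<kappa>) = deg (Omega k m) \<kappa>"
      unfolding ** using p G(2,4,5)[of p q] * by simp_all
    fix \<mu> assume \<mu>: "\<mu> \<in> Mor (Omega k m)" "src (Omega k m) \<kappa> = rng (Omega k m) \<mu>"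
    obtain t where t: "\<mu> = (q, t)" using \<mu>(2) by (cases \<mu>) (simp add: pq Omega_def)
    note \<mu>' = \<mu>(1)[unfolded t Omega_Mor]
    have "(p, t) \<in> Mor (Omega k m)" using * \<mu>' unfolding Omega_Mor by (blast intro: order_trans)
    moreover have "cmp (Omega k m) \<kappa> \<mu> = (p, t)" by (simp add: pq t Omega_def)
    ultimately show "?g (cmp (Omega k m) \<kappa> \<mu>) = cmp \<Lambda> (?g \<kappa>) (?g \<mu>)"
      using G_cmp[of p q t] * \<mu>' \<mu>(1) \<kappa> by (simp add: pq t)
  qed
  then have x_in: "x \<in> path_space k \<Lambda>"
    using m_ext by (simp add: path_space_def x_def)
  have seg: "segment x 0 q = P q" if "q \<in> degrees k" "to_ext q \<le> m" for q
  proof -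
    have z: "to_ext 0 \<le> m" using to_ext_mono zero_le_degree that by blast
    have P0: "src \<Lambda> (P 0) = rng \<Lambda> (G 0 q)" "P q = cmp \<Lambda> (P 0) (G 0 q)" "G 0 q \<in> Mor \<Lambda>"
      using G[OF zero_degrees that(1) zero_le_degree that(2)] by auto
    \<comment> \<open>Degree 0 makes \<open>P 0\<close> an identity, so the remainder after it is
      all of \<open>P q\<close>.\<close>
    have "P 0 = ident \<Lambda> (rng \<Lambda> (P 0))" "src \<Lambda> (P 0) = rng \<Lambda> (P 0)"
      using deg_zero_ident[OF PM[OF zero_degrees z]] P(2)[OF zero_degrees z] by auto
    then have "G 0 q = P q" using P0 ident_left[of "G 0 q"] by metis
    then show ?thesis using that z zero_degrees zero_le_degree
      by (simp add: segment_def x_def Omega_def)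
  qed
  show thesis
  proof
    show "x \<in> path_space k \<Lambda>" by (fact x_in)
    fix a assume a: "a \<in> Mor \<Lambda>"
    have m: "path_deg x = m" by (simp add: x_def path_deg_def)
    show "x \<in> cylinder k \<Lambda> a \<longleftrightarrow> a \<in> S"
    proof
      assume "x \<in> cylinder k \<Lambda> a"
      then show "a \<in> S"
        using seg[OF deg_degrees[OF a]] P(1)[OF deg_degrees[OF a]] by (simp add: cylinder_def m)
    next
      assume "a \<in> S"
      then show "x \<in> cylinder k \<Lambda> a"
        using x_in seg[OF deg_degrees[OF a]] P_eq[of a] le_m[of a] by (simp add: cylinder_def m)
    qed
  qed
qed

text \<open>The segment \<open>x(0, 0)\<close> shows nonemptiness; prefix closure and directedness
  are \<open>cylinder_prefix\<close> and \<open>cylinder_MCE\<close>. Together with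
  \<open>path_of_filter\<close> this identifies the filters with the families of cylinders through a
  path.\<close>

lemma path_filter_of_path:
  assumes x: "x \<in> path_space k \<Lambda>"
  shows "path_filter {a \<in> Mor \<Lambda>. x \<in> cylinder k \<Lambda> a}"
proof -
  have le: "to_ext 0 \<le> path_deg x"
    by (simp add: to_ext_def le_fun_def zero_enat_def[symmetric])
  have "segment x 0 0 \<in> Mor \<Lambda>"
    using path_space_D(1)[OF x zero_degrees zero_degrees zero_le_degree le] .
  moreover note segment_in_cylinder[OF x zero_degrees le]
  moreover have "\<exists>\<kappa>\<in>MCE \<Lambda> \<mu> \<nu>. \<kappa> \<in> {a \<in> Mor \<Lambda>. x \<in> cylinder k \<Lambda> a}"
    if mn: "\<mu> \<in> {a \<in> Mor \<Lambda>. x \<in> cylinder k \<Lambda> a}" "\<nu> \<in> {a \<in> Mor \<Lambda>. x \<in> cylinder k \<Lambda> a}" for \<mu> \<nu>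
  proof -
    obtain \<kappa> where \<kappa>: "\<kappa> \<in> MCE \<Lambda> \<mu> \<nu>" "x \<in> cylinder k \<Lambda> \<kappa>"
      using cylinder_MCE[of x \<mu> \<nu>] mn by blast
    moreover have "\<kappa> \<in> Mor \<Lambda>" using \<kappa>(1) by (simp add: MCE_def)
    ultimately show ?thesis by blast
  qed
  ultimately show ?thesis
    unfolding path_filter_def using cylinder_prefix prefix_Mor by blast
qed

section \<open>The initial topology: clopen and compact cylinders\<close>

abbreviation indicator_topology :: "('m \<Rightarrow> nat) topology" where
  "indicator_topology \<equiv> product_topology (\<lambda>_. discrete_topology {0, 1}) (Mor \<Lambda>)"

lemma cylinder_indicator_topspace: "cylinder_indicator k \<Lambda> w \<in> topspace indicator_topology"
  by (simp add: cylinder_indicator_def)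

lemma topspace_initial: "topspace (initial_topology k \<Lambda>) = path_space k \<Lambda>"
  unfolding initial_topology_def topspace_pullback_topology
  using cylinder_indicator_topspace by blast

lemma coordinate_clopen:
  assumes "a \<in> Mor \<Lambda>"
  shows "openin indicator_topology {f \<in> topspace indicator_topology. f a \<in> V}"
    and "closedin indicator_topology {f \<in> topspace indicator_topology. f a \<in> V}"
proof -
  have cont: "continuous_map indicator_topology (discrete_topology {0, 1}) (\<lambda>f. f a)"
    using assms by (rule continuous_map_product_projection)
  \<comment> \<open>Open and closed sets of the discrete factor must be subsets of
    \<open>{0, 1}\<close>, whereas \<open>V\<close> is arbitrary; all values in question lie in
    \<open>{0, 1}\<close> anyway.\<close>
  have eq: "{f \<in> topspace indicator_topology. f a \<in> V} =
      {f \<in> topspace indicator_topology. f a \<in> V \<inter> {0, 1}}"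
    using assms by (auto simp: PiE_iff)
  show "openin indicator_topology {f \<in> topspace indicator_topology. f a \<in> V}"
    unfolding eq by (rule openin_continuous_map_preimage[OF cont]) simp
  show "closedin indicator_topology {f \<in> topspace indicator_topology. f a \<in> V}"
    unfolding eq by (rule closedin_continuous_map_preimage[OF cont]) simp
qed

lemma cylinder_subset: "cylinder k \<Lambda> a \<subseteq> path_space k \<Lambda>"
  by (auto simp: cylinder_def)

lemma openin_initial_cylinder:
  assumes "a \<in> Mor \<Lambda>"
  shows "openin (initial_topology k \<Lambda>) (cylinder k \<Lambda> a)"
    and "openin (initial_topology k \<Lambda>) (path_space k \<Lambda> - cylinder k \<Lambda> a)"
proof -
  have "cylinder k \<Lambda> a = cylinder_indicator k \<Lambda> -` {f \<in> topspace indicator_topology. f a \<in> {1}} \<inter>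
      path_space k \<Lambda>"
    using assms cylinder_subset cylinder_indicator_topspace
    by (auto simp: cylinder_indicator_def split: if_splits)
  then show "openin (initial_topology k \<Lambda>) (cylinder k \<Lambda> a)"
    unfolding initial_topology_def openin_pullback_topology
    using coordinate_clopen(1)[OF assms] by blast
  have "path_space k \<Lambda> - cylinder k \<Lambda> a =
      cylinder_indicator k \<Lambda> -` {f \<in> topspace indicator_topology. f a \<in> {0}} \<inter> path_space k \<Lambda>"
    using assms cylinder_subset cylinder_indicator_topspace
    by (auto simp: cylinder_indicator_def split: if_splits)
  then show "openin (initial_topology k \<Lambda>) (path_space k \<Lambda> - cylinder k \<Lambda> a)"
    unfolding initial_topology_def openin_pullback_topology
    using coordinate_clopen(1)[OF assms] by blast
qed

text \<open>One inclusion is \<open>path_filter_of_path\<close>, the other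
  \<open>path_of_filter\<close>. The image is thereby described by conditions on coordinates alone,
  with no mention of paths, so that its closedness can be checked.\<close>

lemma cylinder_indicator_image:
  assumes "a \<in> Mor \<Lambda>"
  shows "cylinder_indicator k \<Lambda> ` cylinder k \<Lambda> a =
    {f \<in> topspace indicator_topology. f a = 1 \<and> path_filter {b \<in> Mor \<Lambda>. f b = 1}}"
proof (intro equalityI subsetI)
  fix f assume "f \<in> cylinder_indicator k \<Lambda> ` cylinder k \<Lambda> a"
  then obtain x where x: "x \<in> cylinder k \<Lambda> a" "f = cylinder_indicator k \<Lambda> x" by blast
  then have "{b \<in> Mor \<Lambda>. f b = 1} = {b \<in> Mor \<Lambda>. x \<in> cylinder k \<Lambda> b}" "f a = 1"
    using assms by (auto simp: cylinder_indicator_def)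
  then show "f \<in> {f \<in> topspace indicator_topology. f a = 1 \<and> path_filter {b \<in> Mor \<Lambda>. f b = 1}}"
    using x cylinder_subset path_filter_of_path[of x] cylinder_indicator_topspace[of x] by auto
next
  fix f assume "f \<in> {f \<in> topspace indicator_topology. f a = 1 \<and> path_filter {b \<in> Mor \<Lambda>. f b = 1}}"
  then have f: "f \<in> topspace indicator_topology" "f a = 1" "path_filter {b \<in> Mor \<Lambda>. f b = 1}"
    by auto
  obtain x where x: "\<And>b. b \<in> Mor \<Lambda> \<Longrightarrow> x \<in> cylinder k \<Lambda> b \<longleftrightarrow> b \<in> {b \<in> Mor \<Lambda>. f b = 1}"
    using path_of_filter[OF f(3)] by blast
  have "f = cylinder_indicator k \<Lambda> x"
  proof
    fix b show "f b = cylinder_indicator k \<Lambda> x b"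
      using f(1) x[of b] by (cases "b \<in> Mor \<Lambda>") (auto simp: cylinder_indicator_def PiE_iff extensional_def)
  qed
  moreover have "x \<in> cylinder k \<Lambda> a" using x[OF assms] assms f(2) by simp
  ultimately show "f \<in> cylinder_indicator k \<Lambda> ` cylinder k \<Lambda> a" by blast
qed

text \<open>The explicit \<open>topspace X\<close> covers an empty index set, for which the bare
  intersection would be the whole type.\<close>

lemma closedin_topspace_INT:
  assumes "\<And>i. i \<in> I \<Longrightarrow> closedin X (S i)"
  shows "closedin X (topspace X \<inter> (\<Inter>i\<in>I. S i))"
proof -
  have "closedin X (\<Inter>(insert (topspace X) (S ` I)))"
    by (rule closedin_Inter) (use assms in auto)
  then show ?thesis by simp
qed

lemma closedin_cylinder_indicator_image:
  assumes fa: "finitely_aligned \<Lambda>" and a: "a \<in> Mor \<Lambda>"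
  shows "closedin indicator_topology (cylinder_indicator k \<Lambda> ` cylinder k \<Lambda> a)"
proof -
  let ?T = "topspace indicator_topology"
  define Z where "Z b v = {f \<in> ?T. f b \<in> {v}}" for b and v :: nat
  have Z_iff: "f \<in> Z b v \<longleftrightarrow> f b = v" if "f \<in> ?T" for f b v
    using that by (simp add: Z_def)
  have Z_closed: "closedin indicator_topology (Z b v)" if "b \<in> Mor \<Lambda>" for b v
    unfolding Z_def by (rule coordinate_clopen(2)[OF that])
  \<comment> \<open>\<open>A\<close> expresses closure under prefixes, \<open>B\<close> directedness; the union in \<open>B\<close> is finite.\<close>
  define A where "A p = Z (fst p) 1 \<union> Z (snd p) 0" for p
  define B where "B p = (\<Union>\<kappa>\<in>MCE \<Lambda> (fst p) (snd p). Z \<kappa> 1) \<union> (Z (fst p) 0 \<union> Z (snd p) 0)" for p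
  have MCE_Mor: "MCE \<Lambda> \<mu> \<nu> \<subseteq> Mor \<Lambda>" for \<mu> \<nu> by (auto simp: MCE_def)
  have A_closed: "closedin indicator_topology (A p)" if "p \<in> {(b, \<kappa>). prefix b \<kappa>}" for p
    unfolding A_def using that prefix_Mor by (intro closedin_Un Z_closed) auto
  have B_closed: "closedin indicator_topology (B p)" if p: "p \<in> Mor \<Lambda> \<times> Mor \<Lambda>" for p
  proof -
    have fin: "finite (MCE \<Lambda> (fst p) (snd p))"
      using fa p unfolding finitely_aligned_def by auto
    have "closedin indicator_topology (\<Union>\<kappa>\<in>MCE \<Lambda> (fst p) (snd p). Z \<kappa> 1)"
      by (rule closedin_Union) (use fin MCE_Mor Z_closed in blast)+
    then show ?thesis
      unfolding B_def using p by (intro closedin_Un Z_closed) auto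
  qed
  \<comment> \<open>On \<open>{0, 1}\<close> the negation of \<open>f b = 1\<close> is again a
    closed coordinate condition. This turns the implications in the filter axioms into the unions of
    closed sets in \<open>A\<close> and \<open>B\<close>.\<close>
  have zero_iff: "f b = 0 \<longleftrightarrow> f b \<noteq> 1" if "f \<in> ?T" "b \<in> Mor \<Lambda>" for f b
    using that by (auto simp: PiE_iff)
  have "f \<in> (Z a 1 \<inter> (?T \<inter> (\<Inter>p\<in>{(b, \<kappa>). prefix b \<kappa>}. A p))) \<inter> (?T \<inter> (\<Inter>p\<in>Mor \<Lambda> \<times> Mor \<Lambda>. B p)) \<longleftrightarrow>
      f \<in> ?T \<and> f a = 1 \<and> path_filter {b \<in> Mor \<Lambda>. f b = 1}" for f
  proof (cases "f \<in> ?T \<and> f a = 1")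
    case False
    then show ?thesis unfolding Z_def by blast
  next
    case True
    then have T: "f \<in> ?T" and fa: "f a = 1" by auto
    have A: "f \<in> A (b, \<kappa>) \<longleftrightarrow> (f \<kappa> = 1 \<longrightarrow> f b = 1)" if "prefix b \<kappa>" for b \<kappa>
      unfolding A_def fst_conv snd_conv Un_iff Z_iff[OF T]
        zero_iff[OF T conjunct2[OF prefix_Mor[OF that]]] by blast
    have B: "f \<in> B (\<mu>, \<nu>) \<longleftrightarrow> (f \<mu> = 1 \<longrightarrow> f \<nu> = 1 \<longrightarrow> (\<exists>\<kappa>\<in>MCE \<Lambda> \<mu> \<nu>. f \<kappa> = 1))"
      if "\<mu> \<in> Mor \<Lambda>" "\<nu> \<in> Mor \<Lambda>" for \<mu> \<nu>
      unfolding B_def fst_conv snd_conv Un_iff UN_iff Z_iff[OF T] zero_iff[OF T that(1)]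
        zero_iff[OF T that(2)] by blast
    have "f \<in> Z a 1" using Z_iff[OF T] fa by simp
    then have "f \<in> (Z a 1 \<inter> (?T \<inter> (\<Inter>p\<in>{(b, \<kappa>). prefix b \<kappa>}. A p))) \<inter> (?T \<inter> (\<Inter>p\<in>Mor \<Lambda> \<times> Mor \<Lambda>. B p)) \<longleftrightarrow>
        (\<forall>b \<kappa>. prefix b \<kappa> \<longrightarrow> f \<in> A (b, \<kappa>)) \<and> (\<forall>\<mu>\<in>Mor \<Lambda>. \<forall>\<nu>\<in>Mor \<Lambda>. f \<in> B (\<mu>, \<nu>))"
      using T by blast
    also have "\<dots> \<longleftrightarrow> (\<forall>b \<kappa>. prefix b \<kappa> \<longrightarrow> f \<kappa> = 1 \<longrightarrow> f b = 1) \<and>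
        (\<forall>\<mu>\<in>Mor \<Lambda>. \<forall>\<nu>\<in>Mor \<Lambda>. f \<mu> = 1 \<longrightarrow> f \<nu> = 1 \<longrightarrow> (\<exists>\<kappa>\<in>MCE \<Lambda> \<mu> \<nu>. f \<kappa> = 1))"
      by (simp only: A B cong: imp_cong ball_cong)
    also have "\<dots> \<longleftrightarrow> path_filter {b \<in> Mor \<Lambda>. f b = 1}"
    proof -
      define S where "S = {b \<in> Mor \<Lambda>. f b = 1}"
      have S_iff: "b \<in> S \<longleftrightarrow> f b = 1" if "b \<in> Mor \<Lambda>" for b
        using that by (simp add: S_def)
      have "(\<forall>b \<kappa>. prefix b \<kappa> \<longrightarrow> f \<kappa> = 1 \<longrightarrow> f b = 1) \<longleftrightarrow>
          (\<forall>b \<kappa>. prefix b \<kappa> \<longrightarrow> \<kappa> \<in> S \<longrightarrow> b \<in> S)"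
        using prefix_Mor by (simp add: S_iff cong: imp_cong)
      also have "\<dots> \<longleftrightarrow> (\<forall>\<kappa>\<in>S. \<forall>b. prefix b \<kappa> \<longrightarrow> b \<in> S)"
        by blast
      finally have 1: "(\<forall>b \<kappa>. prefix b \<kappa> \<longrightarrow> f \<kappa> = 1 \<longrightarrow> f b = 1) \<longleftrightarrow>
          (\<forall>\<kappa>\<in>S. \<forall>b. prefix b \<kappa> \<longrightarrow> b \<in> S)" .
      have "(\<exists>\<kappa>\<in>MCE \<Lambda> \<mu> \<nu>. f \<kappa> = 1) \<longleftrightarrow> (\<exists>\<kappa>\<in>MCE \<Lambda> \<mu> \<nu>. \<kappa> \<in> S)" for \<mu> \<nu>
        by (intro bex_cong refl) (use MCE_Mor S_iff in blast)
      then have "(\<forall>\<mu>\<in>Mor \<Lambda>. \<forall>\<nu>\<in>Mor \<Lambda>. f \<mu> = 1 \<longrightarrow> f \<nu> = 1 \<longrightarrow> (\<exists>\<kappa>\<in>MCE \<Lambda> \<mu> \<nu>. f \<kappa> = 1)) \<longleftrightarrow>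
          (\<forall>\<mu>\<in>Mor \<Lambda>. \<forall>\<nu>\<in>Mor \<Lambda>. \<mu> \<in> S \<longrightarrow> \<nu> \<in> S \<longrightarrow> (\<exists>\<kappa>\<in>MCE \<Lambda> \<mu> \<nu>. \<kappa> \<in> S))"
        by (simp only: S_iff cong: ball_cong)
      also have "\<dots> \<longleftrightarrow> (\<forall>\<mu>\<in>S. \<forall>\<nu>\<in>S. \<exists>\<kappa>\<in>MCE \<Lambda> \<mu> \<nu>. \<kappa> \<in> S)"
        unfolding S_def by blast
      finally have 2: "(\<forall>\<mu>\<in>Mor \<Lambda>. \<forall>\<nu>\<in>Mor \<Lambda>. f \<mu> = 1 \<longrightarrow> f \<nu> = 1 \<longrightarrow>
            (\<exists>\<kappa>\<in>MCE \<Lambda> \<mu> \<nu>. f \<kappa> = 1)) \<longleftrightarrow>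
          (\<forall>\<mu>\<in>S. \<forall>\<nu>\<in>S. \<exists>\<kappa>\<in>MCE \<Lambda> \<mu> \<nu>. \<kappa> \<in> S)" .
      \<comment> \<open>The zero function satisfies prefix closure and directedness vacuously. The
        condition \<open>f a = 1\<close> rules it out, which is why the image of a single cylinder
        is considered instead of the image of the whole path space.\<close>
      have "S \<noteq> {}" "S \<subseteq> Mor \<Lambda>" using a fa by (auto simp: S_def)
      then show ?thesis unfolding S_def[symmetric] path_filter_def 1 2 by simp
    qed
    finally show ?thesis using T fa by blast
  qed
  then have "cylinder_indicator k \<Lambda> ` cylinder k \<Lambda> a =
      (Z a 1 \<inter> (?T \<inter> (\<Inter>p\<in>{(b, \<kappa>). prefix b \<kappa>}. A p))) \<inter> (?T \<inter> (\<Inter>p\<in>Mor \<Lambda> \<times> Mor \<Lambda>. B p))"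
    unfolding cylinder_indicator_image[OF a] by blast
  moreover have "closedin indicator_topology \<dots>"
    by (intro closedin_Int Z_closed a closedin_topspace_INT A_closed B_closed)
  ultimately show ?thesis by (simp only:)
qed

text \<open>The image of the cylinder is closed in a compact product, hence compact. Open sets of
  the initial topology are preimages, so an open cover of the cylinder passes to the image and a
  finite subcover pulls back.\<close>

lemma compactin_cylinder:
  assumes fa: "finitely_aligned \<Lambda>" and a: "a \<in> Mor \<Lambda>"
  shows "compactin (initial_topology k \<Lambda>) (cylinder k \<Lambda> a)"
  unfolding compactin_def topspace_initial
proof (intro conjI allI impI cylinder_subset)
  let ?\<alpha> = "cylinder_indicator k \<Lambda>"
  have "compact_space indicator_topology"
    by (simp add: compact_space_product_topology compact_space_discrete_topology)
  then have comp: "compactin indicator_topology (?\<alpha> ` cylinder k \<Lambda> a)"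
    using closedin_cylinder_indicator_image[OF fa a] closedin_compact_space by blast
  fix \<U> assume \<U>: "(\<forall>U\<in>\<U>. openin (initial_topology k \<Lambda>) U) \<and> cylinder k \<Lambda> a \<subseteq> \<Union>\<U>"
  \<comment> \<open>Collecting all open sets whose preimage belongs to the cover avoids choosing one
    for each member.\<close>
  let ?V = "{V. openin indicator_topology V \<and> ?\<alpha> -` V \<inter> path_space k \<Lambda> \<in> \<U>}"
  have "?\<alpha> ` cylinder k \<Lambda> a \<subseteq> \<Union>?V"
  proof
    fix f assume "f \<in> ?\<alpha> ` cylinder k \<Lambda> a"
    then obtain x U where x: "f = ?\<alpha> x" "x \<in> U" "U \<in> \<U>" using \<U> by blast
    then obtain V where V: "openin indicator_topology V" "U = ?\<alpha> -` V \<inter> path_space k \<Lambda>"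
      using \<U> unfolding initial_topology_def openin_pullback_topology by blast
    then show "f \<in> \<Union>?V" using x by blast
  qed
  then obtain \<F> where \<F>: "finite \<F>" "\<F> \<subseteq> ?V" "?\<alpha> ` cylinder k \<Lambda> a \<subseteq> \<Union>\<F>"
    using comp unfolding compactin_def by (metis (no_types, lifting) mem_Collect_eq)
  let ?G = "(\<lambda>V. ?\<alpha> -` V \<inter> path_space k \<Lambda>) ` \<F>"
  have "finite ?G" "?G \<subseteq> \<U>" using \<F> by auto
  moreover have "cylinder k \<Lambda> a \<subseteq> \<Union>?G"
  proof
    fix x assume x: "x \<in> cylinder k \<Lambda> a"
    then obtain V where "V \<in> \<F>" "?\<alpha> x \<in> V" using \<F>(3) by blast
    moreover have "x \<in> path_space k \<Lambda>" using x cylinder_subset by blast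
    ultimately show "x \<in> \<Union>?G" by blast
  qed
  ultimately show "\<exists>\<F>. finite \<F> \<and> \<F> \<subseteq> \<U> \<and> cylinder k \<Lambda> a \<subseteq> \<Union>\<F>" by blast
qed

section \<open>Separation and local compactness\<close>

text \<open>Paths lying in the same cylinders have the same degree and the same initial segments, so
  they are equal. Distinct paths are therefore separated by some cylinder and its complement, both
  of which are open.\<close>

lemma Hausdorff_initial: "Hausdorff_space (initial_topology k \<Lambda>)"
  unfolding Hausdorff_space_def topspace_initial
proof (intro allI impI)
  fix x y assume *: "x \<in> path_space k \<Lambda> \<and> y \<in> path_space k \<Lambda> \<and> x \<noteq> y"
  then have x: "x \<in> path_space k \<Lambda>" and y: "y \<in> path_space k \<Lambda>" by auto
  have "\<exists>a\<in>Mor \<Lambda>. x \<in> cylinder k \<Lambda> a \<longleftrightarrow> y \<notin> cylinder k \<Lambda> a"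
  proof (rule ccontr)
    assume "\<not> ?thesis"
    then have same: "\<And>a. a \<in> Mor \<Lambda> \<Longrightarrow> x \<in> cylinder k \<Lambda> a \<longleftrightarrow> y \<in> cylinder k \<Lambda> a" by blast
    \<comment> \<open>The cylinder used is the one of the segment \<open>u(0, q)\<close>
      itself.\<close>
    have transfer: "to_ext q \<le> path_deg v \<and> segment u 0 q = segment v 0 q"
      if "u \<in> path_space k \<Lambda>" "q \<in> degrees k" "to_ext q \<le> path_deg u"
        "\<And>a. a \<in> Mor \<Lambda> \<Longrightarrow> u \<in> cylinder k \<Lambda> a \<Longrightarrow> v \<in> cylinder k \<Lambda> a" for u v q
    proof -
      have "v \<in> cylinder k \<Lambda> (segment u 0 q)"
        using path_space_D(1)[OF that(1) zero_degrees that(2) zero_le_degree that(3)]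
          segment_in_cylinder[OF that(1-3)] by (rule that(4))
      then show ?thesis
        using path_space_D(2)[OF that(1) zero_degrees that(2) zero_le_degree that(3)]
        by (simp add: cylinder_def)
    qed
    have deg_le: "path_deg u i \<le> path_deg v i"
      if uv: "u \<in> path_space k \<Lambda>" "v \<in> path_space k \<Lambda>"
        "\<And>a. a \<in> Mor \<Lambda> \<Longrightarrow> u \<in> cylinder k \<Lambda> a \<Longrightarrow> v \<in> cylinder k \<Lambda> a" for u v i
    proof (cases "i < k")
      case False
      then show ?thesis using uv(1,2)
        by (auto simp: path_space_def path_deg_def ext_degrees_def)
    next
      case True
      \<comment> \<open>Degrees may be infinite, so they are compared through the finite
        \<open>j\<close> below them, tested on the degree that is \<open>j\<close> in coordinate
        \<open>i\<close> and 0 elsewhere.\<close>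
      have "enat j \<le> path_deg v i" if j: "enat j \<le> path_deg u i" for j
      proof -
        let ?q = "\<lambda>l. if l = i then j else 0"
        have "?q \<in> degrees k" using True by (simp add: degrees_def)
        moreover have "to_ext ?q \<le> path_deg u"
          using j by (simp add: to_ext_def le_fun_def zero_enat_def[symmetric])
        ultimately have "to_ext ?q \<le> path_deg v" using transfer[OF uv(1)] uv(3) by blast
        then have "to_ext ?q i \<le> path_deg v i" by (rule le_funD)
        then show ?thesis by (simp add: to_ext_def)
      qed
      moreover have "u \<le> v" if "\<And>j. enat j \<le> u \<Longrightarrow> enat j \<le> v" for u v :: enat
      proof (cases v)
        case (enat n)
        show ?thesis
        proof (rule ccontr)
          assume "\<not> u \<le> v"
          then have "enat (Suc n) \<le> u" by (simp add: enat Suc_ile_eq not_le)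
          then show False using that[of "Suc n"] by (simp add: enat)
        qed
      qed simp
      ultimately show ?thesis by blast
    qed
    have "path_deg x = path_deg y"
      using deg_le[OF x y] deg_le[OF y x] same by (intro ext antisym) blast+
    then have "x = y"
      using path_eqI[OF x y] transfer[OF x] same by blast
    then show False using * by blast
  qed
  then obtain a where a: "a \<in> Mor \<Lambda>" "x \<in> cylinder k \<Lambda> a \<longleftrightarrow> y \<notin> cylinder k \<Lambda> a" by blast
  let ?Z = "cylinder k \<Lambda> a" and ?N = "path_space k \<Lambda> - cylinder k \<Lambda> a"
  have "disjnt ?Z ?N" "disjnt ?N ?Z" by (auto simp: disjnt_def)
  then show "\<exists>U V. openin (initial_topology k \<Lambda>) U \<and> openin (initial_topology k \<Lambda>) V \<and>
      x \<in> U \<and> y \<in> V \<and> disjnt U V"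
    using openin_initial_cylinder[OF a(1)] a(2) x y by (cases "x \<in> ?Z") blast+
qed

text \<open>Every path lies in some cylinder, which serves both as the open neighbourhood and as the
  compact set.\<close>

lemma locally_compact_initial:
  assumes "finitely_aligned \<Lambda>"
  shows "locally_compact_space (initial_topology k \<Lambda>)"
  unfolding locally_compact_space_def topspace_initial
proof (intro ballI)
  fix x assume x: "x \<in> path_space k \<Lambda>"
  obtain a where "a \<in> Mor \<Lambda>" "x \<in> cylinder k \<Lambda> a"
    using path_filter_of_path[OF x] unfolding path_filter_def by blast
  then show "\<exists>U K. openin (initial_topology k \<Lambda>) U \<and> compactin (initial_topology k \<Lambda>) K \<and>
      x \<in> U \<and> U \<subseteq> K"
    using openin_initial_cylinder(1) compactin_cylinder[OF assms] by blast
qed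

section \<open>The base of the initial topology\<close>

lemma openin_path_base:
  assumes "U \<in> path_base k \<Lambda>"
  shows "openin (initial_topology k \<Lambda>) U"
proof -
  obtain \<mu> G where U: "U = cylinder_diff k \<Lambda> \<mu> G" "\<mu> \<in> Mor \<Lambda>" "finite G"
    "G \<subseteq> edges_at k \<Lambda> (src \<Lambda> \<mu>)"
    using assms unfolding path_base_def by blast
  have "cmp \<Lambda> \<mu> \<nu> \<in> Mor \<Lambda>" if "\<nu> \<in> G" for \<nu>
  proof -
    have "\<nu> \<in> Mor \<Lambda>" "rng \<Lambda> \<nu> = src \<Lambda> \<mu>" using U(4) that by (auto simp: edges_at_def)
    then show ?thesis using U(2) by (simp add: cmp_Mor)
  qed
  then have "openin (initial_topology k \<Lambda>) (path_space k \<Lambda> - cylinder k \<Lambda> (cmp \<Lambda> \<mu> \<nu>))"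
    if "\<nu> \<in> G" for \<nu>
    using that openin_initial_cylinder(2) by blast
  then have "closedin (initial_topology k \<Lambda>) (cylinder k \<Lambda> (cmp \<Lambda> \<mu> \<nu>))" if "\<nu> \<in> G" for \<nu>
    using that cylinder_subset by (simp add: closedin_def topspace_initial)
  then have "closedin (initial_topology k \<Lambda>) (\<Union>\<nu>\<in>G. cylinder k \<Lambda> (cmp \<Lambda> \<mu> \<nu>))"
    using U(3) by (intro closedin_Union) auto
  then show ?thesis
    unfolding U(1) cylinder_diff_def by (intro openin_diff openin_initial_cylinder(1) U(2))
qed

text \<open>A basic open set of the product constrains only finitely many coordinates, here those in
  \<open>F\<close>. The lemma supplies a member of the base that respects these constraints.\<close>

lemma path_base_within_coordinates:
  assumes fa: "finitely_aligned \<Lambda>" and x: "x \<in> path_space k \<Lambda>" and F: "finite F" "F \<subseteq> Mor \<Lambda>"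
  shows "\<exists>B\<in>path_base k \<Lambda>. x \<in> B \<and>
    (\<forall>y\<in>B. \<forall>a\<in>F. y \<in> cylinder k \<Lambda> a \<longleftrightarrow> x \<in> cylinder k \<Lambda> a)"
proof -
  \<comment> \<open>The sum is merely a convenient common bound for the degrees in
    \<open>F\<close>.\<close>
  define N where "N i = (\<Sum>a\<in>F. deg \<Lambda> a i)" for i
  have N: "deg \<Lambda> a i \<le> N i" if "a \<in> F" for a i
    unfolding N_def using that F(1) by (auto intro: member_le_sum)
  \<comment> \<open>The minimum with \<open>N\<close> keeps \<open>n\<close> finite even if
    \<open>d(x)\<close> is not. In each coordinate where \<open>n\<close> is below \<open>N\<close>
    it equals \<open>d(x)\<close>, so \<open>x\<close> cannot be continued there.\<close>
  define n where "n i = the_enat (min (path_deg x i) (enat (N i)))" for i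
  have n_eq: "enat (n i) = min (path_deg x i) (enat (N i))" for i
    unfolding n_def by (cases "path_deg x i") (simp_all add: min_def)
  have n: "n \<in> degrees k"
  proof -
    have "path_deg x i = 0" if "i \<ge> k" for i
      using x that by (auto simp: path_space_def path_deg_def ext_degrees_def)
    then show ?thesis by (simp add: degrees_def n_def zero_enat_def)
  qed
  have le: "to_ext n \<le> path_deg x"
    by (simp add: to_ext_def le_fun_def n_eq)
  define \<nu> where "\<nu> = segment x 0 n"
  have \<nu>: "\<nu> \<in> Mor \<Lambda>" "deg \<Lambda> \<nu> = n" "x \<in> cylinder k \<Lambda> \<nu>"
    using path_space_D(1,2)[OF x zero_degrees n zero_le_degree le] segment_in_cylinder[OF x n le]
    by (simp_all add: \<nu>_def)
  define K where "K = (\<Union>a\<in>F. MCE \<Lambda> \<nu> a)"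
  have "finite K" unfolding K_def using F fa \<nu>(1) unfolding finitely_aligned_def by blast
  \<comment> \<open>The removed edges are those through which a path in the cylinder of \<nu> could
    reach an element of \<open>K\<close>; the ones that \<open>x\<close> itself follows are kept, so
    \<open>x\<close> stays in the difference.\<close>
  define G where "G = {\<beta> \<in> edges_at k \<Lambda> (src \<Lambda> \<nu>). x \<notin> cylinder k \<Lambda> (cmp \<Lambda> \<nu> \<beta>) \<and>
    (\<exists>\<kappa>\<in>K. prefix (cmp \<Lambda> \<nu> \<beta>) \<kappa>)}"
  have "finite G"
  proof -
    let ?E = "\<lambda>\<kappa> i. {\<beta> \<in> Mor \<Lambda>. rng \<Lambda> \<beta> = src \<Lambda> \<nu> \<and> deg \<Lambda> \<beta> = unit_degree i \<and>
      prefix (cmp \<Lambda> \<nu> \<beta>) \<kappa>}"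
    have "finite (?E \<kappa> i)" for \<kappa> i
    proof -
      \<comment> \<open>For fixed \<kappa> and \<open>i\<close> there is at most one such edge,
        since \<kappa> has only one prefix of degree \<open>n\<close> plus the unit degree of
        \<open>i\<close>.\<close>
      have same: "\<beta> = \<beta>'" if b: "\<beta> \<in> ?E \<kappa> i" "\<beta>' \<in> ?E \<kappa> i" for \<beta> \<beta>'
      proof -
        have b1: "\<beta> \<in> Mor \<Lambda>" "src \<Lambda> \<nu> = rng \<Lambda> \<beta>" "deg \<Lambda> \<beta> = unit_degree i" "prefix (cmp \<Lambda> \<nu> \<beta>) \<kappa>"
          and b2: "\<beta>' \<in> Mor \<Lambda>" "src \<Lambda> \<nu> = rng \<Lambda> \<beta>'" "deg \<Lambda> \<beta>' = unit_degree i"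
            "prefix (cmp \<Lambda> \<nu> \<beta>') \<kappa>"
          using b by auto
        have "cmp \<Lambda> \<nu> \<beta> = cmp \<Lambda> \<nu> \<beta>'"
          by (rule prefix_same_deg[OF b1(4) b2(4)])
            (simp add: deg_cmp[OF \<nu>(1) b1(1,2)] deg_cmp[OF \<nu>(1) b2(1,2)] b1(3) b2(3))
        from factor_unique(2)[OF \<nu>(1) b1(1,2) \<nu>(1) b2(1,2) this refl] show ?thesis .
      qed
      show ?thesis
      proof (cases "?E \<kappa> i = {}")
        case False
        then obtain \<beta> where "\<beta> \<in> ?E \<kappa> i" by blast
        then have "?E \<kappa> i \<subseteq> {\<beta>}" using same by blast
        then show ?thesis by (rule finite_subset) simp
      qed (simp only: finite.emptyI)
    qed
    moreover have "G \<subseteq> (\<Union>\<kappa>\<in>K. \<Union>i<k. ?E \<kappa> i)"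
      unfolding G_def edges_at_def by blast
    ultimately show ?thesis using \<open>finite K\<close> by (meson finite_UN_I finite_lessThan finite_subset)
  qed
  show ?thesis
  proof (intro bexI conjI ballI)
    show "cylinder_diff k \<Lambda> \<nu> G \<in> path_base k \<Lambda>"
      unfolding path_base_def using \<nu>(1) \<open>finite G\<close> G_def by blast
    show "x \<in> cylinder_diff k \<Lambda> \<nu> G"
      unfolding cylinder_diff_def using \<nu>(3) G_def by blast
    fix y a assume y: "y \<in> cylinder_diff k \<Lambda> \<nu> G" and a: "a \<in> F"
    have aM: "a \<in> Mor \<Lambda>" using a F(2) by blast
    have y\<nu>: "y \<in> cylinder k \<Lambda> \<nu>" using y by (simp add: cylinder_diff_def)
    show "y \<in> cylinder k \<Lambda> a \<longleftrightarrow> x \<in> cylinder k \<Lambda> a"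
    proof
      assume xa: "x \<in> cylinder k \<Lambda> a"
      \<comment> \<open>The degree of \<open>a\<close> is bounded both by \<open>d(x)\<close> and by
        \<open>N\<close>, hence by their minimum; so \<open>a\<close> is a prefix of \<nu> and its
        cylinder contains that of \<nu>.\<close>
      have "deg \<Lambda> a \<le> n"
      proof (rule le_funI)
        fix i
        have "enat (deg \<Lambda> a i) \<le> path_deg x i"
          using xa by (auto simp: cylinder_def to_ext_def le_fun_def)
        then have "enat (deg \<Lambda> a i) \<le> enat (n i)" using N[OF a] by (simp add: n_eq)
        then show "deg \<Lambda> a i \<le> n i" by simp
      qed
      then have "prefix a \<nu>"
        unfolding \<nu>_def using cylinder_segment_prefix[OF xa aM n le] by blast
      then show "y \<in> cylinder k \<Lambda> a" using cylinder_prefix[OF y\<nu>] by blast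
    next
      assume ya: "y \<in> cylinder k \<Lambda> a"
      obtain \<kappa> where \<kappa>: "\<kappa> \<in> MCE \<Lambda> \<nu> a" "y \<in> cylinder k \<Lambda> \<kappa>"
        using cylinder_MCE[OF y\<nu> ya \<nu>(1) aM] by blast
      then have \<kappa>': "prefix \<nu> \<kappa>" "prefix a \<kappa>" "deg \<Lambda> \<kappa> = sup n (deg \<Lambda> a)"
        using MCE_iff[OF \<nu>(1) aM] \<nu>(2) by auto
      obtain \<gamma> where \<gamma>: "\<gamma> \<in> Mor \<Lambda>" "src \<Lambda> \<nu> = rng \<Lambda> \<gamma>" "\<kappa> = cmp \<Lambda> \<nu> \<gamma>"
        using \<kappa>'(1) unfolding prefix_def by blast
      have deg_\<gamma>: "n i + deg \<Lambda> \<gamma> i = max (n i) (deg \<Lambda> a i)" for i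
        using fun_cong[OF \<kappa>'(3), of i] deg_cmp[OF \<nu>(1) \<gamma>(1,2)] \<nu>(2) \<gamma>(3) by (simp add: sup_max)
      show "x \<in> cylinder k \<Lambda> a"
      \<comment> \<open>If \<gamma> is trivial, then \<open>a\<close> is a prefix of \<nu>.
        Otherwise the first edge of \<gamma> in some direction \<open>i\<close> belongs to
        \<open>G\<close>, contradicting the choice of \<open>y\<close>.\<close>
      proof (cases "deg \<Lambda> \<gamma> = 0")
        case True
        then have "\<nu> = \<kappa>"
          using prefix_full_deg[OF \<kappa>'(1)] deg_cmp[OF \<nu>(1) \<gamma>(1,2)] \<gamma>(3) by simp
        then show ?thesis using cylinder_prefix \<nu>(3) \<kappa>'(2) by blast
      next
        case False
        then obtain i where i: "deg \<Lambda> \<gamma> i > 0" by (auto simp: fun_eq_iff)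
        have "i < k" using i deg_zero_outside[OF \<gamma>(1), of i] by (cases "i < k") auto
        have "unit_degree i \<in> degrees k" "unit_degree i \<le> deg \<Lambda> \<gamma>"
          using i \<open>i < k\<close> by (auto simp: unit_degree_def degrees_def le_fun_def)
        then obtain \<beta> \<delta> where \<beta>: "\<beta> \<in> Mor \<Lambda>" "\<delta> \<in> Mor \<Lambda>" "src \<Lambda> \<beta> = rng \<Lambda> \<delta>" "\<gamma> = cmp \<Lambda> \<beta> \<delta>"
          "deg \<Lambda> \<beta> = unit_degree i"
          using factor_exists[OF \<gamma>(1)] by metis
        have rng_\<beta>: "rng \<Lambda> \<beta> = src \<Lambda> \<nu>" using \<gamma>(2) \<beta> rng_cmp[OF \<beta>(1-3)] by simp
        have "prefix (cmp \<Lambda> \<nu> \<beta>) (cmp \<Lambda> (cmp \<Lambda> \<nu> \<beta>) \<delta>)"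
          using \<nu>(1) \<beta>(1-3) rng_\<beta> by (intro prefix_cmp) (simp_all add: cmp_Mor src_cmp)
        then have pre: "prefix (cmp \<Lambda> \<nu> \<beta>) \<kappa>"
          using cmp_assoc[OF \<nu>(1) \<beta>(1,2) rng_\<beta>[symmetric] \<beta>(3)] \<gamma>(3) \<beta>(4) by simp
        \<comment> \<open>The truncation of \<open>d(x)\<close> at \<open>N\<close> is not active in a coordinate where \<open>a\<close> exceeds \<open>n\<close>.\<close>
        have "path_deg x i < enat (Suc (n i))"
        proof -
          have "deg \<Lambda> a i > n i" using deg_\<gamma>[of i] i by (simp add: max_def split: if_splits)
          then have "n i < N i" using N[OF a, of i] by linarith
          then have "path_deg x i = enat (n i)" using n_eq[of i] by (auto simp: min_def split: if_splits)
          then show ?thesis by simp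
        qed
        moreover have "deg \<Lambda> (cmp \<Lambda> \<nu> \<beta>) i = Suc (n i)"
          using deg_cmp[OF \<nu>(1) \<beta>(1) rng_\<beta>[symmetric]] \<nu>(2) \<beta>(5) by (simp add: unit_degree_def)
        ultimately have "x \<notin> cylinder k \<Lambda> (cmp \<Lambda> \<nu> \<beta>)"
          unfolding cylinder_def to_ext_def le_fun_def
          by (metis (mono_tags, lifting) linorder_not_less mem_Collect_eq)
        moreover have "\<beta> \<in> edges_at k \<Lambda> (src \<Lambda> \<nu>)"
          unfolding edges_at_def using \<beta>(1,5) rng_\<beta> \<open>i < k\<close> by blast
        ultimately have "\<beta> \<in> G" unfolding G_def K_def using pre \<kappa>(1) a by blast
        moreover have "y \<in> cylinder k \<Lambda> (cmp \<Lambda> \<nu> \<beta>)" using cylinder_prefix[OF \<kappa>(2) pre] .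
        ultimately show ?thesis using y by (auto simp: cylinder_diff_def)
      qed
    qed
  qed
qed

text \<open>Members of the base are open, and every point of an open set has a member of the base
  around it inside that set. Hence the unions of members of the base are exactly the open sets, and
  so they form a topology.\<close>

lemma openin_initial_iff:
  assumes fa: "finitely_aligned \<Lambda>"
  shows "openin (initial_topology k \<Lambda>) = arbitrary union_of (\<lambda>U. U \<in> path_base k \<Lambda>)"
proof (intro ext iffI)
  fix U assume "(arbitrary union_of (\<lambda>U. U \<in> path_base k \<Lambda>)) U"
  then show "openin (initial_topology k \<Lambda>) U"
    unfolding union_of_def using openin_path_base by blast
next
  fix U assume "openin (initial_topology k \<Lambda>) U"
  then obtain V where V: "openin indicator_topology V"
      "U = cylinder_indicator k \<Lambda> -` V \<inter> path_space k \<Lambda>"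
    unfolding initial_topology_def openin_pullback_topology by blast
  have "\<exists>B. B \<in> path_base k \<Lambda> \<and> x \<in> B \<and> B \<subseteq> U" if xU: "x \<in> U" for x
  proof -
    have x: "x \<in> path_space k \<Lambda>" "cylinder_indicator k \<Lambda> x \<in> V" using xU V(2) by auto
    \<comment> \<open>This is a box around the indicator of \<open>x\<close> with only finitely many
      proper factors; their indices are the set to which \<open>path_base_within_coordinates\<close>
      is applied.\<close>
    obtain W where W: "finite {a \<in> Mor \<Lambda>. W a \<noteq> topspace (discrete_topology {0, 1})}"
      "cylinder_indicator k \<Lambda> x \<in> Pi\<^sub>E (Mor \<Lambda>) W" "Pi\<^sub>E (Mor \<Lambda>) W \<subseteq> V"
      using V(1) x(2) unfolding openin_product_topology_alt by blast
    let ?F = "{a \<in> Mor \<Lambda>. W a \<noteq> topspace (discrete_topology {0, 1})}"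
    from path_base_within_coordinates[OF fa x(1) W(1) Collect_restrict]
    obtain B where B: "B \<in> path_base k \<Lambda>" "x \<in> B"
      "\<forall>y\<in>B. \<forall>a\<in>?F. y \<in> cylinder k \<Lambda> a \<longleftrightarrow> x \<in> cylinder k \<Lambda> a"
      by blast
    have "B \<subseteq> U"
    proof
      fix y assume y: "y \<in> B"
      have "cylinder_indicator k \<Lambda> y a \<in> W a" if a: "a \<in> Mor \<Lambda>" for a
      proof (cases "a \<in> ?F")
        case True
        then have "cylinder_indicator k \<Lambda> y a = cylinder_indicator k \<Lambda> x a"
          using bspec[OF bspec[OF B(3) y] True] by (simp add: cylinder_indicator_def)
        then show ?thesis using PiE_mem[OF W(2) a] by simp
      next
        case False
        then have "W a = {0, 1}" using a by simp
        then show ?thesis using a by (simp add: cylinder_indicator_def)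
      qed
      then have "cylinder_indicator k \<Lambda> y \<in> Pi\<^sub>E (Mor \<Lambda>) W"
        by (simp add: PiE_iff cylinder_indicator_def)
      then have "cylinder_indicator k \<Lambda> y \<in> V" using W(3) by blast
      moreover have "y \<in> path_space k \<Lambda>"
        using openin_subset[OF openin_path_base[OF B(1)]] y by (auto simp: topspace_initial)
      ultimately show "y \<in> U" using V(2) by blast
    qed
    then show ?thesis using B by blast
  qed
  then show "(arbitrary union_of (\<lambda>U. U \<in> path_base k \<Lambda>)) U"
    unfolding arbitrary_union_of_alt by blast
qed

end

theorem theorem3p2:
  fixes k :: nat and \<Lambda> :: "('o, 'm) kgraph_data"
  assumes "kgraph k \<Lambda>" and "finitely_aligned \<Lambda>"
  shows "openin (path_topology k \<Lambda>) = arbitrary union_of (\<lambda>U. U \<in> path_base k \<Lambda>) \<and>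
         topspace (path_topology k \<Lambda>) = path_space k \<Lambda> \<and>
         path_topology k \<Lambda> = initial_topology k \<Lambda> \<and>
         locally_compact_space (path_topology k \<Lambda>) \<and>
         Hausdorff_space (path_topology k \<Lambda>)"
proof -
  interpret kgraph k \<Lambda> by fact
  \<comment> \<open>The unions of members of the base are already known to be the open sets of a
    topology, so \<open>topology\<close> applied to them returns that topology; the axioms need no
    separate check.\<close>
  have "path_topology k \<Lambda> = initial_topology k \<Lambda>"
    unfolding path_topology_def openin_initial_iff[OF assms(2), symmetric] by (rule openin_inverse)
  then show ?thesis
    using openin_initial_iff[OF assms(2)] topspace_initial locally_compact_initial[OF assms(2)]
      Hausdorff_initial
    by simp
qed

end
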